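(* Let $\mathcal{F}=\{f_i\}_{i\in I}$ be a frame for a Krein space $\mathcal{H}$. Then the following conditions are equivalent: (1) $\mathcal{F}$ is a Parseval $J$-frame for $\mathcal{H}$; (2) there exist a Krein space $\mathcal{K}$ with a fundamental decomposition $\mathcal{K}=\mathcal{K}_+[\dotplus]\mathcal{K}_-$, containing $\mathcal{H}$ as a regular subspace, and a $[\cdot,\cdot]_{\mathcal{K}}$-orthonormal basis $\{b_i\}_{i\in I}$ of $\mathcal{K}$, such that $\{f_i\}_{i\in I_+}\subseteq\mathcal{K}_+$, $\{f_i\}_{i\in I_-}\subseteq\mathcal{K}_-$ and $$f_i=Eb_i\quad\text{for every } i\in I,$$ where $E\in L(\mathcal{K})$ is the $J$-selfadjoint projection onto $\mathcal{H}$.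
   Context: A (complex) Krein space is a vector space $\mathcal{H}$ with a hermitian sesquilinear form $[\cdot,\cdot]$ admitting a fundamental decomposition $\mathcal{H}=\mathcal{H}_+[\dotplus]\mathcal{H}_-$, i.e. direct and $[\cdot,\cdot]$-orthogonal, with $(\mathcal{H}_+,[\cdot,\cdot])$ and $(\mathcal{H}_-,-[\cdot,\cdot])$ Hilbert spaces. Fix one; the associated Hilbert inner product is $\langle x,y\rangle=[x_+,y_+]-[x_-,y_-]$, with norm $\|\cdot\|$ (the topology does not depend on the decomposition). $L(\mathcal{K})$ denotes the bounded linear operators on $\mathcal{K}$. For a subspace $\mathcal{S}$, $\mathcal{S}^{[\perp]}=\{x:[x,s]=0\ \forall s\in\mathcal{S}\}$. A closed subspace $\mathcal{S}$ of a Krein space $\mathcal{K}$ is regular if $\mathcal{K}=\mathcal{S}\dotplus\mathcal{S}^{[\perp]}$; the projection onto $\mathcal{S}$ along $\mathcal{S}^{[\perp]}$ is then the unique $J$-selfadjoint ($E=E^+$) projection onto $\mathcal{S}$. "$\mathcal{K}$ contains $\mathcal{H}$" means that $\mathcal{H}$ is a subspace of $\mathcal{K}$ and $[\cdot,\cdot]_{\mathcal{K}}$ restricts to $[\cdot,\cdot]$ on $\mathcal{H}$. A subspace $\mathcal{S}$ is uniformly $J$-positive (resp. uniformly $J$-negative) if there is $\alpha>0$ with $[x,x]\ge\alpha\|x\|^2$ (resp. $-[x,x]\ge\alpha\|x\|^2$) for all $x\in\mathcal{S}$; it is maximal if it is maximal under inclusion among such subspaces. The adjoint $T^+$ of a bounded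 operator between Krein spaces is defined by $[Tx,y]=[x,T^+y]$. A family $\{f_i\}_{i\in I}$ is a frame for $\mathcal{H}$ if there are $0<\alpha\le\beta$ with $\alpha\|f\|^2\le\sum_i|\langle f,f_i\rangle|^2\le\beta\|f\|^2$ for all $f\in\mathcal{H}$ (Bessel family if only the upper bound is required); its synthesis operator is the bounded operator $T:\ell_2(I)\to\mathcal{H}$, $Tx=\sum_{i\in I}x_if_i$. Put $I_+=\{i: [f_i,f_i]\ge0\}$, $I_-=\{i:[f_i,f_i]<0\}$; $P_\pm$ is the orthogonal projection of $\ell_2(I)$ onto $\ell_2(I_\pm)$ and $T_\pm=TP_\pm$. The Bessel family $\mathcal{F}$ is a $J$-frame for $\mathcal{H}$ if the range $R(T_+)$ is a maximal uniformly $J$-positive subspace and $R(T_-)$ is a maximal uniformly $J$-negative subspace of $\mathcal{H}$. With $\ell_2(I)$ made a Krein space by $[x,y]_2=\sum_{i\in I_+}x_i\overline{y_i}-\sum_{i\in I_-}x_i\overline{y_i}$, a $J$-frame is a Parseval $J$-frame if $TT^+=I$. A $[\cdot,\cdot]_{\mathcal{K}}$-orthonormal basis of $\mathcal{K}$ is a family $\{b_i\}_{i\in I}$ with $[b_i,b_j]_{\mathcal{K}}=\varepsilon_i\delta_{ij}$, $\varepsilon_i\in\{1,-1\}$, such that every $x\in\mathcal{K}$ equals the unconditionally convergent sum $\sum_{i\in I}\varepsilon_i[x,b_i]_{\mathcal{K}}b_i$.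
   Formalization: Condition (2) additionally requires [b_i,b_i]=1 for i in I_+ and [b_i,b_i]=-1 for i in I_- whenever f_i≠0; without this (2) does not imply (1), and every Parseval J-frame with a dilation as in (2) satisfies it. *)

theory Defs
  imports "HOL-Analysis.Analysis" "HOL-Library.Function_Algebras"
begin

text \<open>
  The libraries have no complex inner product spaces. A complex space is therefore a
  \<open>subspace\<close> (in the sense of the locale \<open>module\<close>) of an ambient
  complex vector space given by a scalar multiplication \<open>s\<close> on a type of class
  \<open>ab_group_add\<close>.
\<close>

definition hermitian_on ::
  "(complex \<Rightarrow> 'a::ab_group_add \<Rightarrow> 'a) \<Rightarrow> 'a set \<Rightarrow> ('a \<Rightarrow> 'a \<Rightarrow> complex) \<Rightarrow> bool" where
  "hermitian_on s V q \<longleftrightarrow>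
     (\<forall>x\<in>V. \<forall>y\<in>V. \<forall>z\<in>V. q (x + y) z = q x z + q y z) \<and>
     (\<forall>c. \<forall>x\<in>V. \<forall>z\<in>V. q (s c x) z = c * q x z) \<and>
     (\<forall>x\<in>V. \<forall>y\<in>V. q y x = cnj (q x y))"

text \<open>
  The metric of the inner product \<open>q\<close> on \<open>V\<close>. The locale \<open>Metric_space\<close> wants
  nonnegativity and symmetry on the whole type, hence the value 0 outside \<open>V\<close>.
\<close>

definition form_dist :: "'a::ab_group_add set \<Rightarrow> ('a \<Rightarrow> 'a \<Rightarrow> complex) \<Rightarrow> 'a \<Rightarrow> 'a \<Rightarrow> real" where
  "form_dist V q x y =
     (if x \<in> V \<and> y \<in> V then sqrt (Re (q (x - y) (x - y))) else 0)"

definition hilbert_on ::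
  "(complex \<Rightarrow> 'a::ab_group_add \<Rightarrow> 'a) \<Rightarrow> 'a set \<Rightarrow> ('a \<Rightarrow> 'a \<Rightarrow> complex) \<Rightarrow> bool" where
  "hilbert_on s V q \<longleftrightarrow>
     module.subspace s V \<and> hermitian_on s V q \<and>
     (\<forall>x\<in>V. x \<noteq> 0 \<longrightarrow> 0 < Re (q x x)) \<and>
     Metric_space.mcomplete V (form_dist V q)"

definition direct_sum :: "'a::ab_group_add set \<Rightarrow> 'a set \<Rightarrow> 'a set \<Rightarrow> bool" where
  "direct_sum V A B \<longleftrightarrow> V = {a + b |a b. a \<in> A \<and> b \<in> B} \<and> A \<inter> B = {0}"

text \<open>A Krein space together with the fundamental decomposition that has been fixed for it.\<close>

record 'a krein =
  scl :: "complex \<Rightarrow> 'a \<Rightarrow> 'a"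
  pts :: "'a set"
  form :: "'a \<Rightarrow> 'a \<Rightarrow> complex"
  pos :: "'a set"
  neg :: "'a set"

definition krein_space :: "'a::ab_group_add krein \<Rightarrow> bool" where
  "krein_space K \<longleftrightarrow>
     vector_space (scl K) \<and> module.subspace (scl K) (pts K) \<and>
     hermitian_on (scl K) (pts K) (form K) \<and>
     direct_sum (pts K) (pos K) (neg K) \<and>
     (\<forall>x\<in>pos K. \<forall>y\<in>neg K. form K x y = 0) \<and>
     hilbert_on (scl K) (pos K) (form K) \<and>
     hilbert_on (scl K) (neg K) (\<lambda>x y. - form K x y)"

text \<open>The component in \<open>A\<close> of \<open>x\<close>, for a direct sum of \<open>A\<close> and \<open>B\<close>.\<close>

definition component :: "'a::ab_group_add set \<Rightarrow> 'a set \<Rightarrow> 'a \<Rightarrow> 'a" where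
  "component A B x = (THE a. a \<in> A \<and> (\<exists>b\<in>B. x = a + b))"

definition hinner :: "'a::ab_group_add krein \<Rightarrow> 'a \<Rightarrow> 'a \<Rightarrow> complex" where
  "hinner K x y =
     form K (component (pos K) (neg K) x) (component (pos K) (neg K) y) -
     form K (component (neg K) (pos K) x) (component (neg K) (pos K) y)"

definition hnorm :: "'a::ab_group_add krein \<Rightarrow> 'a \<Rightarrow> real" where
  "hnorm K x = sqrt (Re (hinner K x x))"

definition htopology :: "'a::ab_group_add krein \<Rightarrow> 'a topology" where
  "htopology K = Metric_space.mtopology (pts K) (form_dist (pts K) (hinner K))"

text \<open>Unconditional convergence: the net of finite partial sums converges in norm.\<close>

definition has_usum :: "'a::ab_group_add krein \<Rightarrow> ('i \<Rightarrow> 'a) \<Rightarrow> 'i set \<Rightarrow> 'a \<Rightarrow> bool" where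
  "has_usum K g I y \<longleftrightarrow> limitin (htopology K) (sum g) y (finite_subsets_at_top I)"

definition subspace_of :: "'a::ab_group_add krein \<Rightarrow> 'a set \<Rightarrow> bool" where
  "subspace_of K S \<longleftrightarrow> module.subspace (scl K) S \<and> S \<subseteq> pts K"

definition form_compl :: "'a::ab_group_add krein \<Rightarrow> 'a set \<Rightarrow> 'a set" where
  "form_compl K S = {x \<in> pts K. \<forall>y\<in>S. form K x y = 0}"

definition regular_subspace :: "'a::ab_group_add krein \<Rightarrow> 'a set \<Rightarrow> bool" where
  "regular_subspace K S \<longleftrightarrow>
     subspace_of K S \<and> closedin (htopology K) S \<and> direct_sum (pts K) S (form_compl K S)"

definition unif_pos :: "'a::ab_group_add krein \<Rightarrow> 'a set \<Rightarrow> bool" where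
  "unif_pos K S \<longleftrightarrow> subspace_of K S \<and>
     (\<exists>\<alpha>>0. \<forall>x\<in>S. Re (form K x x) \<ge> \<alpha> * (hnorm K x)\<^sup>2)"

definition unif_neg :: "'a::ab_group_add krein \<Rightarrow> 'a set \<Rightarrow> bool" where
  "unif_neg K S \<longleftrightarrow> subspace_of K S \<and>
     (\<exists>\<alpha>>0. \<forall>x\<in>S. - Re (form K x x) \<ge> \<alpha> * (hnorm K x)\<^sup>2)"

definition maximal_unif_pos :: "'a::ab_group_add krein \<Rightarrow> 'a set \<Rightarrow> bool" where
  "maximal_unif_pos K S \<longleftrightarrow> unif_pos K S \<and> (\<forall>S'. unif_pos K S' \<and> S \<subseteq> S' \<longrightarrow> S' = S)"

definition maximal_unif_neg :: "'a::ab_group_add krein \<Rightarrow> 'a set \<Rightarrow> bool" where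
  "maximal_unif_neg K S \<longleftrightarrow> unif_neg K S \<and> (\<forall>S'. unif_neg K S' \<and> S \<subseteq> S' \<longrightarrow> S' = S)"

text \<open>
  \<open>krein_adjoint V q W r T T'\<close> says that \<open>T'\<close> is the adjoint of \<open>T\<close>, where \<open>T\<close> maps
  \<open>V\<close> with form \<open>q\<close> to \<open>W\<close> with form \<open>r\<close>. As Krein space forms are nondegenerate, this
  determines \<open>T'\<close> on \<open>W\<close>.
\<close>

definition krein_adjoint ::
  "'a set \<Rightarrow> ('a \<Rightarrow> 'a \<Rightarrow> complex) \<Rightarrow> 'b set \<Rightarrow> ('b \<Rightarrow> 'b \<Rightarrow> complex) \<Rightarrow>
   ('a \<Rightarrow> 'b) \<Rightarrow> ('b \<Rightarrow> 'a) \<Rightarrow> bool" where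
  "krein_adjoint V q W r T T' \<longleftrightarrow>
     T ` V \<subseteq> W \<and> T' ` W \<subseteq> V \<and> (\<forall>x\<in>V. \<forall>y\<in>W. r (T x) y = q x (T' y))"

definition linear_between :: "'a::ab_group_add krein \<Rightarrow> 'b::ab_group_add krein \<Rightarrow> ('a \<Rightarrow> 'b) \<Rightarrow> bool"
  where
  "linear_between H K T \<longleftrightarrow> T ` pts H \<subseteq> pts K \<and>
     (\<forall>x\<in>pts H. \<forall>y\<in>pts H. T (x + y) = T x + T y) \<and>
     (\<forall>c. \<forall>x\<in>pts H. T (scl H c x) = scl K c (T x))"

definition bounded_operator :: "'a::ab_group_add krein \<Rightarrow> ('a \<Rightarrow> 'a) \<Rightarrow> bool" where
  "bounded_operator K T \<longleftrightarrow> linear_between K K T \<and>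
     (\<exists>C. \<forall>x\<in>pts K. hnorm K (T x) \<le> C * hnorm K x)"

definition selfadjoint_projection_onto :: "'a::ab_group_add krein \<Rightarrow> 'a set \<Rightarrow> ('a \<Rightarrow> 'a) \<Rightarrow> bool"
  where
  "selfadjoint_projection_onto K S E \<longleftrightarrow>
     bounded_operator K E \<and> (\<forall>x\<in>pts K. E (E x) = E x) \<and> E ` pts K = S \<and>
     krein_adjoint (pts K) (form K) (pts K) (form K) E E"

text \<open>
  Summability is required explicitly, since \<open>infsum\<close> is 0 for families that are not summable.
\<close>

definition bessel_family :: "'a::ab_group_add krein \<Rightarrow> 'i set \<Rightarrow> ('i \<Rightarrow> 'a) \<Rightarrow> bool" where
  "bessel_family H I f \<longleftrightarrow> f ` I \<subseteq> pts H \<and>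
     (\<exists>\<beta>>0. \<forall>x\<in>pts H.
        (\<lambda>i. (cmod (hinner H x (f i)))\<^sup>2) summable_on I \<and>
        (\<Sum>\<^sub>\<infinity>i\<in>I. (cmod (hinner H x (f i)))\<^sup>2) \<le> \<beta> * (hnorm H x)\<^sup>2)"

definition frame :: "'a::ab_group_add krein \<Rightarrow> 'i set \<Rightarrow> ('i \<Rightarrow> 'a) \<Rightarrow> bool" where
  "frame H I f \<longleftrightarrow> f ` I \<subseteq> pts H \<and>
     (\<exists>\<alpha> \<beta>. 0 < \<alpha> \<and> \<alpha> \<le> \<beta> \<and> (\<forall>x\<in>pts H.
        (\<lambda>i. (cmod (hinner H x (f i)))\<^sup>2) summable_on I \<and>
        \<alpha> * (hnorm H x)\<^sup>2 \<le> (\<Sum>\<^sub>\<infinity>i\<in>I. (cmod (hinner H x (f i)))\<^sup>2) \<and>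
        (\<Sum>\<^sub>\<infinity>i\<in>I. (cmod (hinner H x (f i)))\<^sup>2) \<le> \<beta> * (hnorm H x)\<^sup>2))"

definition idx_pos :: "'a krein \<Rightarrow> 'i set \<Rightarrow> ('i \<Rightarrow> 'a) \<Rightarrow> 'i set" where
  "idx_pos H I f = {i \<in> I. Re (form H (f i) (f i)) \<ge> 0}"

definition idx_neg :: "'a krein \<Rightarrow> 'i set \<Rightarrow> ('i \<Rightarrow> 'a) \<Rightarrow> 'i set" where
  "idx_neg H I f = {i \<in> I. Re (form H (f i) (f i)) < 0}"

text \<open>Elements of \<open>ell2 I\<close> are extended by 0 outside \<open>I\<close>.\<close>

definition ell2 :: "'i set \<Rightarrow> ('i \<Rightarrow> complex) set" where
  "ell2 I = {x. (\<forall>i. i \<notin> I \<longrightarrow> x i = 0) \<and> (\<lambda>i. (cmod (x i))\<^sup>2) summable_on I}"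

definition ell2_form :: "'i set \<Rightarrow> 'i set \<Rightarrow> ('i \<Rightarrow> complex) \<Rightarrow> ('i \<Rightarrow> complex) \<Rightarrow> complex" where
  "ell2_form A B x y = (\<Sum>\<^sub>\<infinity>i\<in>A. x i * cnj (y i)) - (\<Sum>\<^sub>\<infinity>i\<in>B. x i * cnj (y i))"

definition ell2_restrict :: "'i set \<Rightarrow> ('i \<Rightarrow> complex) \<Rightarrow> ('i \<Rightarrow> complex)" where
  "ell2_restrict J x = (\<lambda>i. if i \<in> J then x i else 0)"

definition synthesis :: "'a::ab_group_add krein \<Rightarrow> 'i set \<Rightarrow> ('i \<Rightarrow> 'a) \<Rightarrow> ('i \<Rightarrow> complex) \<Rightarrow> 'a" where
  "synthesis H I f x = (THE y. has_usum H (\<lambda>i. scl H (x i) (f i)) I y)"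

definition J_frame :: "'a::ab_group_add krein \<Rightarrow> 'i set \<Rightarrow> ('i \<Rightarrow> 'a) \<Rightarrow> bool" where
  "J_frame H I f \<longleftrightarrow> bessel_family H I f \<and>
     maximal_unif_pos H ((\<lambda>x. synthesis H I f (ell2_restrict (idx_pos H I f) x)) ` ell2 I) \<and>
     maximal_unif_neg H ((\<lambda>x. synthesis H I f (ell2_restrict (idx_neg H I f) x)) ` ell2 I)"

definition parseval_J_frame :: "'a::ab_group_add krein \<Rightarrow> 'i set \<Rightarrow> ('i \<Rightarrow> 'a) \<Rightarrow> bool" where
  "parseval_J_frame H I f \<longleftrightarrow> J_frame H I f \<and>
     (\<exists>T'. krein_adjoint (ell2 I) (ell2_form (idx_pos H I f) (idx_neg H I f))
             (pts H) (form H) (synthesis H I f) T' \<and>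
           (\<forall>y\<in>pts H. synthesis H I f (T' y) = y))"

definition orthonormal_basis ::
  "'a::ab_group_add krein \<Rightarrow> 'i set \<Rightarrow> ('i \<Rightarrow> 'a) \<Rightarrow> ('i \<Rightarrow> complex) \<Rightarrow> bool" where
  "orthonormal_basis K I b \<epsilon> \<longleftrightarrow> b ` I \<subseteq> pts K \<and> \<epsilon> ` I \<subseteq> {1, - 1} \<and>
     (\<forall>i\<in>I. \<forall>j\<in>I. form K (b i) (b j) = (if i = j then \<epsilon> i else 0)) \<and>
     (\<forall>x\<in>pts K. has_usum K (\<lambda>i. scl K (\<epsilon> i * form K x (b i)) (b i)) I x)"

text \<open>
  A Krein space \<open>K\<close> contains \<open>H\<close> when \<open>H\<close> is identified, by an isometric embedding \<open>\<iota>\<close>,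
  with a subspace of \<open>K\<close>: \<open>H\<close> may be all of its type, so literal inclusion is no option.
\<close>

definition contains_via :: "'k::ab_group_add krein \<Rightarrow> 'a::ab_group_add krein \<Rightarrow> ('a \<Rightarrow> 'k) \<Rightarrow> bool" where
  "contains_via K H \<iota> \<longleftrightarrow> linear_between H K \<iota> \<and> inj_on \<iota> (pts H) \<and>
     (\<forall>x\<in>pts H. \<forall>y\<in>pts H. form K (\<iota> x) (\<iota> y) = form H x y)"

text \<open>
  The final clause says that the basis has the signature of the family: \<open>\<epsilon> i = 1\<close> on
  the indices of \<open>I\<^sub>+\<close> and \<open>\<epsilon> i = - 1\<close> on those of \<open>I\<^sub>-\<close>, except where \<open>f i = 0\<close>. It does
  not follow from the other clauses. Let \<open>K\<close> have the orthonormal basis \<open>b 1\<close>, \<open>b 2\<close> with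
  signs 1, -1, let \<open>H\<close> be spanned by \<open>h = cosh t * b 1 + sinh t * b 2\<close>, \<open>pos K = H\<close> and
  \<open>neg K\<close> its complement. Then \<open>E (b 1) = cosh t * h\<close> and \<open>E (b 2) = - sinh t * h\<close> lie in
  \<open>pos K\<close> and form a frame for \<open>H\<close>, which is not a Parseval J-frame for \<open>t \<noteq> 0\<close>, because
  \<open>T T\<^sup>+ = cosh\<^sup>2 t + sinh\<^sup>2 t\<close>. Conversely, given the other clauses, each Parseval
  J-frame satisfies this clause.
\<close>

definition regular_dilation ::
  "'a::ab_group_add krein \<Rightarrow> 'i set \<Rightarrow> ('i \<Rightarrow> 'a) \<Rightarrow>
   'k::ab_group_add krein \<Rightarrow> ('a \<Rightarrow> 'k) \<Rightarrow> ('i \<Rightarrow> 'k) \<Rightarrow> ('i \<Rightarrow> complex) \<Rightarrow> ('k \<Rightarrow> 'k) \<Rightarrow> bool" where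
  "regular_dilation H I f K \<iota> b \<epsilon> E \<longleftrightarrow>
     krein_space K \<and> contains_via K H \<iota> \<and> regular_subspace K (\<iota> ` pts H) \<and>
     orthonormal_basis K I b \<epsilon> \<and>
     \<iota> ` f ` idx_pos H I f \<subseteq> pos K \<and> \<iota> ` f ` idx_neg H I f \<subseteq> neg K \<and>
     selfadjoint_projection_onto K (\<iota> ` pts H) E \<and>
     (\<forall>i\<in>I. \<iota> (f i) = E (b i)) \<and>
     (\<forall>i\<in>I. f i \<noteq> 0 \<longrightarrow> \<epsilon> i = (if i \<in> idx_pos H I f then 1 else - 1))"

end

theory Submission
  imports Defs
begin

text \<open>
  Write \<open>I\<^sub>p\<close>, \<open>I\<^sub>n\<close> for the two index sets of the signature, \<open>T\<close> for the synthesis operator and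
  \<open>T\<^sup>+\<close> (\<open>analysis\<close> below) for its adjoint with respect to the indefinite forms, so that
  \<open>(T\<^sup>+ y) i = \<plusminus> [y, f i]\<close> with the sign of \<open>i\<close>. A family is a Parseval J-frame when \<open>T T\<^sup>+ = 1\<close> and
  the two ranges \<open>M\<^sub>p = T (ell2 I\<^sub>p)\<close> and \<open>M\<^sub>n = T (ell2 I\<^sub>n)\<close> are maximal uniformly definite.

  From \<open>T T\<^sup>+ = 1\<close> it follows that \<open>T\<^sup>+\<close> is an isometric embedding of \<open>H\<close> into \<open>ell2 I\<close> with the form
  \<open>[\<cdot>,\<cdot>]\<^sub>2\<close>, and that \<open>E = T\<^sup>+ T\<close> is a selfadjoint projection onto its range which maps the unit vector
  at \<open>i\<close> to \<open>T\<^sup>+ (f i)\<close>. So \<open>ell2 I\<close>, with its obvious fundamental decomposition into \<open>ell2 I\<^sub>p\<close>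
  and \<open>ell2 I\<^sub>n\<close>, is the required dilation, provided that \<open>T\<^sup>+\<close> maps \<open>f i\<close> into \<open>ell2 I\<^sub>p\<close> or \<open>ell2 I\<^sub>n\<close>
  according to the sign of \<open>i\<close>. This is the one point where the definiteness of the two ranges enters
  (\<open>parseval_analysis_supported\<close>): let \<open>x \<in> M\<^sub>p\<close> and split \<open>T\<^sup>+ x = u + v\<close> along \<open>I\<^sub>p\<close> and \<open>I\<^sub>n\<close>.
  Then \<open>T v = x - T u\<close> lies in \<open>M\<^sub>p\<close> and in \<open>M\<^sub>n\<close>, hence vanishes, as no nonzero vector is both
  positive and negative. Therefore \<open>0 = [T v, x] = [v, T\<^sup>+ x]\<^sub>2 = - \<parallel>v\<parallel>\<^sup>2\<close>, that is, \<open>T\<^sup>+ x = u\<close>.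

  Conversely, let \<open>E\<close> project an orthonormal basis \<open>b\<close> of \<open>K\<close> to \<open>f\<close>. For \<open>x\<close>, \<open>z\<close> in \<open>H\<close>, pairing the
  expansion of \<open>x\<close> in this basis with \<open>z\<close> and moving \<open>E\<close> to the other side gives
  \<open>[x, z] = \<Sum> \<epsilon> i * [x, f i] * [f i, z]\<close>, and this says \<open>T T\<^sup>+ x = x\<close> since the form is nondegenerate.
  The fundamental decomposition of \<open>K\<close> makes \<open>M\<^sub>p\<close> and \<open>M\<^sub>n\<close> orthogonal to each other, and
  \<open>x = T T\<^sup>+ x\<close> shows that their sum is \<open>H\<close>. For \<open>x \<in> M\<^sub>p\<close> the family \<open>T\<^sup>+ x\<close> is then supported in \<open>I\<^sub>p\<close>,
  so that \<open>[x, x] = \<Sum> \<bar>[x, f i]\<bar>\<^sup>2\<close>, which the lower frame bound estimates from below by a multiple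
  of \<open>\<parallel>x\<parallel>\<^sup>2\<close> (\<open>uniform_bounds\<close>). So both subspaces are uniformly definite, and two such subspaces
  with sum \<open>H\<close> are automatically maximal (\<open>maximal_unif_decomposition\<close>).

  The remaining work is analytic: completeness of a Krein space in its Hilbert norm, unconditional
  convergence of \<open>\<Sum> x i * f i\<close> for square summable \<open>x\<close>, and completeness of \<open>ell2\<close>.
\<close>

section \<open>Complex inner products on subspaces\<close>

text \<open>
  The Hilbert inner product of a Krein space, the form on either part of its fundamental
  decomposition and the inner product of \<open>ell2\<close> are all of this kind. The norm is the one behind
  \<open>form_dist\<close>, so the facts on \<open>Metric_space\<close> become available for it.
\<close>

locale inner_product_on = vector_space s
  for s :: "complex \<Rightarrow> 'a::ab_group_add \<Rightarrow> 'a" +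
  fixes V :: "'a set" and q :: "'a \<Rightarrow> 'a \<Rightarrow> complex"
  assumes subspace_V: "subspace V"
    and herm: "hermitian_on s V q"
    and pos_def: "\<And>x. x \<in> V \<Longrightarrow> x \<noteq> 0 \<Longrightarrow> 0 < Re (q x x)"
begin

definition nrm :: "'a \<Rightarrow> real" where "nrm x = sqrt (Re (q x x))"

lemma V_add [intro, simp]: "x \<in> V \<Longrightarrow> y \<in> V \<Longrightarrow> x + y \<in> V"
  and V_scale [intro, simp]: "x \<in> V \<Longrightarrow> s c x \<in> V"
  and V_zero [intro, simp]: "0 \<in> V"
  and V_diff [intro, simp]: "x \<in> V \<Longrightarrow> y \<in> V \<Longrightarrow> x - y \<in> V"
  using subspace_V by (auto intro: subspace_add subspace_scale subspace_0 subspace_diff)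

lemma V_sum: "(\<And>i. i \<in> F \<Longrightarrow> g i \<in> V) \<Longrightarrow> sum g F \<in> V"
  using subspace_V by (rule subspace_sum)

lemma q_add_left: "x \<in> V \<Longrightarrow> y \<in> V \<Longrightarrow> z \<in> V \<Longrightarrow> q (x + y) z = q x z + q y z"
  and q_scale_left: "x \<in> V \<Longrightarrow> z \<in> V \<Longrightarrow> q (s c x) z = c * q x z"
  and q_commute: "x \<in> V \<Longrightarrow> y \<in> V \<Longrightarrow> q y x = cnj (q x y)"
  using herm unfolding hermitian_on_def by blast+

lemma q_add_right: "x \<in> V \<Longrightarrow> y \<in> V \<Longrightarrow> z \<in> V \<Longrightarrow> q z (x + y) = q z x + q z y"
  by (metis V_add complex_cnj_add q_commute q_add_left)

lemma q_diff_left: "x \<in> V \<Longrightarrow> y \<in> V \<Longrightarrow> z \<in> V \<Longrightarrow> q (x - y) z = q x z - q y z"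
  using q_add_left[of "x - y" y z] by simp

lemma q_diff_right: "x \<in> V \<Longrightarrow> y \<in> V \<Longrightarrow> z \<in> V \<Longrightarrow> q z (x - y) = q z x - q z y"
  by (metis V_diff complex_cnj_diff q_commute q_diff_left)

lemma q_scale_right: "x \<in> V \<Longrightarrow> z \<in> V \<Longrightarrow> q z (s c x) = cnj c * q z x"
  by (metis V_scale complex_cnj_mult q_commute q_scale_left)

lemma q_zero_left [simp]: "x \<in> V \<Longrightarrow> q 0 x = 0"
  using q_diff_left[of x x x] by simp

lemma Im_q_self: "x \<in> V \<Longrightarrow> Im (q x x) = 0"
  using q_commute[of x x] by (metis cnj.simps(2) neg_equal_zero)

lemma q_self: "x \<in> V \<Longrightarrow> q x x = complex_of_real ((nrm x)\<^sup>2)"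
proof -
  assume x: "x \<in> V"
  have "Re (q x x) \<ge> 0"
    using pos_def[of x] x by (cases "x = 0") auto
  then show ?thesis
    using Im_q_self[OF x] by (simp add: nrm_def complex_eq_iff)
qed

lemma nrm_sq: "x \<in> V \<Longrightarrow> (nrm x)\<^sup>2 = Re (q x x)"
  by (simp add: q_self)

lemma nrm_zero [simp]: "nrm 0 = 0"
  by (simp add: nrm_def)

lemma nrm_nonneg [simp]: "x \<in> V \<Longrightarrow> 0 \<le> nrm x"
proof -
  assume x: "x \<in> V"
  have "Re (q x x) \<ge> 0"
    using pos_def[of x] x by (cases "x = 0") auto
  then show ?thesis by (simp add: nrm_def)
qed

lemma nrm_eq_0: "x \<in> V \<Longrightarrow> nrm x = 0 \<longleftrightarrow> x = 0"
  using pos_def[of x] by (cases "x = 0") (auto simp: nrm_def)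

lemma Cauchy_Schwarz:
  assumes x: "x \<in> V" and y: "y \<in> V"
  shows "cmod (q x y) \<le> nrm x * nrm y"
proof (cases "y = 0")
  case True
  then show ?thesis using x q_commute[of 0 x] by simp
next
  case False
  have ny: "nrm y > 0" using False y nrm_eq_0 nrm_nonneg by (metis less_eq_real_def)
  \<comment> \<open>\<open>x - c y\<close> is the component of \<open>x\<close> orthogonal to \<open>y\<close>.\<close>
  define c where "c = q x y / complex_of_real ((nrm y)\<^sup>2)"
  have "q (x - s c y) (x - s c y) =
      q x x - cnj c * q x y - c * (q y x - cnj c * q y y)"
    using x y by (simp add: q_diff_left q_diff_right q_scale_left q_scale_right algebra_simps)
  also have "q y x - cnj c * q y y = 0"
    using ny q_commute[OF x y] q_self[OF y] by (simp add: c_def)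
  finally have eq: "q (x - s c y) (x - s c y) = q x x - cnj c * q x y" by simp
  have "cnj c * q x y = complex_of_real ((cmod (q x y))\<^sup>2 / (nrm y)\<^sup>2)"
    by (simp add: c_def complex_norm_square mult.commute del: of_real_power)
  then have "Re (q (x - s c y) (x - s c y)) = (nrm x)\<^sup>2 - (cmod (q x y))\<^sup>2 / (nrm y)\<^sup>2"
    unfolding eq using nrm_sq[OF x] by simp
  moreover have "Re (q (x - s c y) (x - s c y)) \<ge> 0"
    using nrm_sq[of "x - s c y"] x y by (metis V_diff V_scale zero_le_power2)
  ultimately have "(cmod (q x y))\<^sup>2 / (nrm y)\<^sup>2 \<le> (nrm x)\<^sup>2" by simp
  then have "(cmod (q x y))\<^sup>2 \<le> (nrm x * nrm y)\<^sup>2"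
    using ny by (simp add: divide_simps power_mult_distrib)
  then show ?thesis
    using x y by (meson mult_nonneg_nonneg nrm_nonneg power2_le_imp_le)
qed

lemma nrm_triangle:
  assumes x: "x \<in> V" and y: "y \<in> V"
  shows "nrm (x + y) \<le> nrm x + nrm y"
proof -
  have "q (x + y) (x + y) = q x x + q y y + (q x y + cnj (q x y))"
    using x y q_commute[OF x y] by (simp add: q_add_left q_add_right)
  then have "(nrm (x + y))\<^sup>2 = (nrm x)\<^sup>2 + (nrm y)\<^sup>2 + 2 * Re (q x y)"
    using x y by (simp add: nrm_sq)
  also have "\<dots> \<le> (nrm x)\<^sup>2 + (nrm y)\<^sup>2 + 2 * (nrm x * nrm y)"
    using Cauchy_Schwarz[OF x y] complex_Re_le_cmod[of "q x y"] by linarith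
  also have "\<dots> = (nrm x + nrm y)\<^sup>2" by (simp add: power2_sum)
  finally show ?thesis
    using x y by (meson add_nonneg_nonneg nrm_nonneg power2_le_imp_le)
qed

lemma nrm_scale: "x \<in> V \<Longrightarrow> nrm (s c x) = cmod c * nrm x"
proof -
  assume x: "x \<in> V"
  have "q (s c x) (s c x) = complex_of_real ((cmod c)\<^sup>2 * (nrm x)\<^sup>2)"
    using x q_self[OF x] complex_norm_square[of c]
    by (simp add: q_scale_left q_scale_right mult.assoc[symmetric])
  then show ?thesis
    using x by (simp add: nrm_def[of "s c x"] real_sqrt_mult)
qed

lemma nrm_uminus: "x \<in> V \<Longrightarrow> nrm (- x) = nrm x"
  using nrm_scale[of x "- 1"] by simp

lemma nrm_minus_commute: "x \<in> V \<Longrightarrow> y \<in> V \<Longrightarrow> nrm (x - y) = nrm (y - x)"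
  using nrm_uminus[of "x - y"] by simp

lemma form_dist_eq: "x \<in> V \<Longrightarrow> y \<in> V \<Longrightarrow> form_dist V q x y = nrm (x - y)"
  by (simp add: form_dist_def nrm_def)

sublocale Metric_space V "form_dist V q"
proof
  fix x y z
  show "0 \<le> form_dist V q x y"
    using nrm_nonneg[of "x - y"] by (auto simp: form_dist_def nrm_def)
  show "form_dist V q x y = form_dist V q y x"
    by (cases "x \<in> V \<and> y \<in> V")
       (auto simp: form_dist_eq nrm_minus_commute, auto simp: form_dist_def)
  assume x: "x \<in> V" and y: "y \<in> V"
  then show "form_dist V q x y = 0 \<longleftrightarrow> x = y"
    by (simp add: form_dist_eq nrm_eq_0)
  assume "z \<in> V"
  then show "form_dist V q x z \<le> form_dist V q x y + form_dist V q y z"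
    using nrm_triangle[of "x - y" "y - z"] x y by (simp add: form_dist_eq)
qed

text \<open>
  Outside \<open>V\<close> the value of \<open>form_dist\<close> is 0 by convention, so the metric and the norm of differences
  agree only along nets that are eventually in \<open>V\<close>.
\<close>

lemma limitin_iff_nrm:
  assumes "\<forall>\<^sub>F i in F. g i \<in> V"
  shows "limitin mtopology g y F \<longleftrightarrow> y \<in> V \<and> ((\<lambda>i. nrm (g i - y)) \<longlongrightarrow> 0) F"
proof -
  have "((\<lambda>i. form_dist V q (g i) y) \<longlongrightarrow> 0) F \<longleftrightarrow> ((\<lambda>i. nrm (g i - y)) \<longlongrightarrow> 0) F"
    if "y \<in> V"
    by (intro filterlim_cong[OF refl refl] eventually_mono[OF assms]) (simp add: that form_dist_eq)
  then show ?thesis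
    using assms by (cases "y \<in> V") (simp_all add: limitin_metric_dist_null)
qed

end

text \<open>
  \<open>mcomplete\<close> speaks of sequences, whereas unconditional sums are limits of nets over the finite
  subsets of a possibly uncountable set. Choosing sets \<open>A n\<close> beyond which the net varies
  by less than \<open>1 / (n + 1)\<close> and passing to their increasing unions gives a Cauchy sequence, and
  its limit is the limit of the net.
\<close>

lemma (in Metric_space) limitin_finite_subsets_of_Cauchy:
  assumes compl: "mcomplete"
    and M: "\<And>F. finite F \<Longrightarrow> F \<subseteq> I \<Longrightarrow> \<sigma> F \<in> M"
    and cauchy: "\<And>e. e > 0 \<Longrightarrow> \<exists>F0. finite F0 \<and> F0 \<subseteq> I \<and>
       (\<forall>F. finite F \<and> F0 \<subseteq> F \<and> F \<subseteq> I \<longrightarrow> d (\<sigma> F0) (\<sigma> F) < e)"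
  shows "\<exists>y. limitin mtopology \<sigma> y (finite_subsets_at_top I)"
proof -
  have "\<exists>F0. finite F0 \<and> F0 \<subseteq> I \<and>
       (\<forall>F. finite F \<and> F0 \<subseteq> F \<and> F \<subseteq> I \<longrightarrow> d (\<sigma> F0) (\<sigma> F) < inverse (Suc n))" for n
    by (rule cauchy) simp
  then obtain A where A: "\<And>n. finite (A n)" "\<And>n. A n \<subseteq> I"
    and dA: "\<And>n F. finite F \<Longrightarrow> A n \<subseteq> F \<Longrightarrow> F \<subseteq> I \<Longrightarrow> d (\<sigma> (A n)) (\<sigma> F) < inverse (Suc n)"
    by metis
  define G where "G n = (\<Union>k\<le>n. A k)" for n
  have G: "finite (G n)" "G n \<subseteq> I" "k \<le> n \<Longrightarrow> A k \<subseteq> G n" for n k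
    using A by (auto simp: G_def)
  have close: "d (\<sigma> F) (\<sigma> F') < 2 * inverse (Suc n)"
    if "finite F" "A n \<subseteq> F" "F \<subseteq> I" "finite F'" "A n \<subseteq> F'" "F' \<subseteq> I" for F F' n
  proof -
    have "\<sigma> F \<in> M" "\<sigma> (A n) \<in> M" "\<sigma> F' \<in> M"
      by (simp_all add: M A that)
    then have "d (\<sigma> F) (\<sigma> F') \<le> d (\<sigma> (A n)) (\<sigma> F) + d (\<sigma> (A n)) (\<sigma> F')"
      by (rule triangle'')
    then show ?thesis using dA[of F n] dA[of F' n] that by linarith
  qed
  have small: "\<exists>n. 2 * inverse (real (Suc n)) < e" if "e > 0" for e
    using reals_Archimedean[of "e / 2"] that by (auto simp: field_simps)
  have "MCauchy (\<lambda>n. \<sigma> (G n))"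
    unfolding MCauchy_def
  proof (intro conjI allI impI)
    show "range (\<lambda>n. \<sigma> (G n)) \<subseteq> M" using G M by auto
    fix e :: real assume "e > 0"
    then obtain n where n: "2 * inverse (real (Suc n)) < e" using small by blast
    have "d (\<sigma> (G k)) (\<sigma> (G k')) < e" if "n \<le> k" "n \<le> k'" for k k'
      using close[OF G(1) G(3)[OF that(1)] G(2) G(1) G(3)[OF that(2)] G(2)] n by linarith
    then show "\<exists>N. \<forall>k k'. N \<le> k \<longrightarrow> N \<le> k' \<longrightarrow> d (\<sigma> (G k)) (\<sigma> (G k')) < e"
      by blast
  qed
  then obtain y where y: "limitin mtopology (\<lambda>n. \<sigma> (G n)) y sequentially"
    using compl by (auto simp: mcomplete_def)
  then have yM: "y \<in> M" by (rule limitin_mspace)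
  have "\<forall>\<^sub>F F in finite_subsets_at_top I. \<sigma> F \<in> M \<and> d (\<sigma> F) y < e" if "e > 0" for e
  proof -
    obtain n where n: "2 * inverse (real (Suc n)) < e / 2" using small[OF half_gt_zero[OF \<open>e > 0\<close>]] by blast
    have "\<forall>\<^sub>F k in sequentially. \<sigma> (G k) \<in> M \<and> d (\<sigma> (G k)) y < e / 2"
      using y half_gt_zero[OF \<open>e > 0\<close>] unfolding limitin_metric by blast
    then have "\<forall>\<^sub>F k in sequentially. n \<le> k \<and> d (\<sigma> (G k)) y < e / 2"
      using eventually_ge_at_top[of n] by eventually_elim simp
    then obtain k where k: "n \<le> k" "d (\<sigma> (G k)) y < e / 2"
      unfolding eventually_sequentially by blast
    have "d (\<sigma> F) y < e" if "finite F" "A n \<subseteq> F" "F \<subseteq> I" for F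
    proof -
      have "\<sigma> F \<in> M" "\<sigma> (G k) \<in> M" by (simp_all add: M G that)
      then have "d (\<sigma> F) y \<le> d (\<sigma> F) (\<sigma> (G k)) + d (\<sigma> (G k)) y"
        using yM by (rule triangle)
      moreover have "d (\<sigma> F) (\<sigma> (G k)) < 2 * inverse (Suc n)"
        by (intro close that G k)
      ultimately show ?thesis using n k by linarith
    qed
    then show ?thesis
      unfolding eventually_finite_subsets_at_top by (intro exI[of _ "A n"]) (simp add: A M)
  qed
  then show ?thesis unfolding limitin_metric using yM by blast
qed

section \<open>Krein spaces and their fundamental symmetry\<close>

text \<open>
  Uniqueness of the summands in a direct sum: two decompositions of the same vector differ by an
  element of \<open>A \<inter> B\<close>.
\<close>

lemma (in vector_space) component_add:
  assumes "subspace A" "subspace B" "A \<inter> B = {0}" "a \<in> A" "b \<in> B"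
  shows "component A B (a + b) = a"
  unfolding component_def
proof (rule the_equality)
  show "a \<in> A \<and> (\<exists>b'\<in>B. a + b = a + b')" using assms by blast
next
  fix a' assume "a' \<in> A \<and> (\<exists>b'\<in>B. a + b = a' + b')"
  then obtain b' where "a' \<in> A" "b' \<in> B" "a + b = a' + b'" by blast
  then have "a' - a \<in> A" "a' - a = b - b'" "b - b' \<in> B"
    using assms by (auto intro: subspace_diff simp: algebra_simps)
  then have "a' - a \<in> A \<inter> B" by simp
  then show "a' = a" using assms by simp
qed

text \<open>
  Besides the Hilbert inner product of the whole space, the form on the positive part and the
  negated form on the negative part are inner products; their facts carry the prefixes
  \<open>pos\<close> and \<open>neg\<close>.
\<close>

locale krein =
  fixes K :: "'a::ab_group_add krein"
  assumes krein_space: "krein_space K"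
begin

sublocale vector_space "scl K"
  using krein_space by (simp add: krein_space_def)

sublocale pos: inner_product_on "scl K" "pos K" "form K"
  using krein_space
  by unfold_locales (auto simp: krein_space_def hilbert_on_def)

sublocale neg: inner_product_on "scl K" "neg K" "\<lambda>x y. - form K x y"
  using krein_space
  by unfold_locales (auto simp: krein_space_def hilbert_on_def)

abbreviation P :: "'a \<Rightarrow> 'a" where "P \<equiv> component (pos K) (neg K)"
abbreviation N :: "'a \<Rightarrow> 'a" where "N \<equiv> component (neg K) (pos K)"

lemma subspace_pts: "subspace (pts K)"
  and herm_form: "hermitian_on (scl K) (pts K) (form K)"
  and pos_neg_Int: "pos K \<inter> neg K = {0}"
  and pts_eq: "pts K = {a + b |a b. a \<in> pos K \<and> b \<in> neg K}"
  using krein_space unfolding krein_space_def direct_sum_def by blast+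

lemma P_add_pos_neg: "a \<in> pos K \<Longrightarrow> b \<in> neg K \<Longrightarrow> P (a + b) = a"
  by (intro component_add pos.subspace_V neg.subspace_V pos_neg_Int)

lemma N_add_pos_neg: "a \<in> pos K \<Longrightarrow> b \<in> neg K \<Longrightarrow> N (a + b) = b"
  using component_add[OF neg.subspace_V pos.subspace_V, of b a] pos_neg_Int
  by (simp add: Int_commute add.commute)

lemma P_in [simp, intro]: "x \<in> pts K \<Longrightarrow> P x \<in> pos K"
  and N_in [simp, intro]: "x \<in> pts K \<Longrightarrow> N x \<in> neg K"
  and P_plus_N: "x \<in> pts K \<Longrightarrow> P x + N x = x"
  using pts_eq P_add_pos_neg N_add_pos_neg by fastforce+

lemma pos_pts [simp, intro]: "x \<in> pos K \<Longrightarrow> x \<in> pts K"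
  and neg_pts [simp, intro]: "x \<in> neg K \<Longrightarrow> x \<in> pts K"
  using pts_eq pos.V_zero neg.V_zero by (metis (mono_tags, lifting) add_0 add.right_neutral mem_Collect_eq)+

lemma P_add: "x \<in> pts K \<Longrightarrow> y \<in> pts K \<Longrightarrow> P (x + y) = P x + P y"
  and N_add: "x \<in> pts K \<Longrightarrow> y \<in> pts K \<Longrightarrow> N (x + y) = N x + N y"
proof -
  assume xy: "x \<in> pts K" "y \<in> pts K"
  have "x + y = (P x + P y) + (N x + N y)"
    using P_plus_N[OF xy(1)] P_plus_N[OF xy(2)] by (metis add.assoc add.left_commute)
  then show "P (x + y) = P x + P y" "N (x + y) = N x + N y"
    using P_add_pos_neg[of "P x + P y" "N x + N y"] N_add_pos_neg[of "P x + P y" "N x + N y"] xy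
    by simp_all
qed

lemma P_scale: "x \<in> pts K \<Longrightarrow> P (scl K c x) = scl K c (P x)"
  and N_scale: "x \<in> pts K \<Longrightarrow> N (scl K c x) = scl K c (N x)"
proof -
  assume x: "x \<in> pts K"
  have "scl K c x = scl K c (P x) + scl K c (N x)"
    using P_plus_N[OF x] by (metis scale_right_distrib)
  then show "P (scl K c x) = scl K c (P x)" "N (scl K c x) = scl K c (N x)"
    using P_add_pos_neg[of "scl K c (P x)" "scl K c (N x)"]
      N_add_pos_neg[of "scl K c (P x)" "scl K c (N x)"] x
    by simp_all
qed

lemma form_add_left: "x \<in> pts K \<Longrightarrow> y \<in> pts K \<Longrightarrow> z \<in> pts K \<Longrightarrow>
    form K (x + y) z = form K x z + form K y z"
  and form_scale_left: "x \<in> pts K \<Longrightarrow> z \<in> pts K \<Longrightarrow> form K (scl K c x) z = c * form K x z"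
  and form_commute: "x \<in> pts K \<Longrightarrow> y \<in> pts K \<Longrightarrow> form K y x = cnj (form K x y)"
  using herm_form unfolding hermitian_on_def by blast+

lemma form_pos_neg: "x \<in> pos K \<Longrightarrow> y \<in> neg K \<Longrightarrow> form K x y = 0"
  using krein_space by (simp add: krein_space_def)

lemma form_neg_pos: "x \<in> neg K \<Longrightarrow> y \<in> pos K \<Longrightarrow> form K x y = 0"
  using form_pos_neg[of y x] form_commute[of y x] by simp

lemma hinner_hermitian: "hermitian_on (scl K) (pts K) (hinner K)"
  unfolding hermitian_on_def
proof (intro conjI ballI allI)
  fix x y z c assume xy: "x \<in> pts K" "y \<in> pts K"
  show "hinner K y x = cnj (hinner K x y)"
    using xy form_commute[of "P x" "P y"] form_commute[of "N x" "N y"] by (simp add: hinner_def)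
  show "hinner K (scl K c x) y = c * hinner K x y"
    using xy by (simp add: hinner_def P_scale N_scale form_scale_left algebra_simps)
  assume z: "z \<in> pts K"
  show "hinner K (x + y) z = hinner K x z + hinner K y z"
    using xy z by (simp add: hinner_def P_add N_add form_add_left algebra_simps)
qed

sublocale inner_product_on "scl K" "pts K" "hinner K"
  rewrites "inner_product_on.nrm (hinner K) = hnorm K"
proof -
  show "inner_product_on (scl K) (pts K) (hinner K)"
  proof (unfold_locales)
    fix x assume x: "x \<in> pts K" "x \<noteq> 0"
    have "0 \<le> Re (form K (P x) (P x))" "0 \<le> - Re (form K (N x) (N x))"
      using x pos.nrm_sq[of "P x"] neg.nrm_sq[of "N x"] by (metis P_in zero_le_power2)
        (metis N_in uminus_complex.sel(1) neg.nrm_sq x(1) zero_le_power2)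
    moreover have "P x \<noteq> 0 \<or> N x \<noteq> 0" using P_plus_N x by force
    ultimately show "0 < Re (hinner K x x)"
      using pos.pos_def[of "P x"] neg.pos_def[of "N x"] x by (auto simp: hinner_def)
  qed (use subspace_pts hinner_hermitian in auto)
  then interpret inner_product_on "scl K" "pts K" "hinner K" .
  show "nrm = hnorm K"
    by (simp add: fun_eq_iff nrm_def hnorm_def)
qed

text \<open>
  The fundamental symmetry. It is isometric for the Hilbert norm and intertwines the two forms, so
  estimates for \<open>hinner\<close> carry over to the indefinite form.
\<close>

definition J :: "'a \<Rightarrow> 'a" where "J x = P x - N x"

lemma J_in [simp, intro]: "x \<in> pts K \<Longrightarrow> J x \<in> pts K"
  by (simp add: J_def)

lemma P_J: "x \<in> pts K \<Longrightarrow> P (J x) = P x" and N_J: "x \<in> pts K \<Longrightarrow> N (J x) = - N x"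
proof -
  assume x: "x \<in> pts K"
  then have "- N x \<in> neg K" using neg.V_scale[of "N x" "- 1"] by simp
  then show "P (J x) = P x" "N (J x) = - N x"
    using P_add_pos_neg[of "P x" "- N x"] N_add_pos_neg[of "P x" "- N x"] x by (simp_all add: J_def)
qed

lemma form_diff_left: "x \<in> pts K \<Longrightarrow> y \<in> pts K \<Longrightarrow> z \<in> pts K \<Longrightarrow>
    form K (x - y) z = form K x z - form K y z"
  using form_add_left[of "x - y" y z] by simp

lemma form_add_right: "x \<in> pts K \<Longrightarrow> y \<in> pts K \<Longrightarrow> z \<in> pts K \<Longrightarrow>
    form K z (x + y) = form K z x + form K z y"
  by (metis V_add complex_cnj_add form_commute form_add_left)

lemma form_diff_right: "x \<in> pts K \<Longrightarrow> y \<in> pts K \<Longrightarrow> z \<in> pts K \<Longrightarrow>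
    form K z (x - y) = form K z x - form K z y"
  using form_add_right[of "x - y" y z] by simp

lemma form_eq: "x \<in> pts K \<Longrightarrow> y \<in> pts K \<Longrightarrow> form K x y = form K (P x) (P y) + form K (N x) (N y)"
proof -
  assume xy: "x \<in> pts K" "y \<in> pts K"
  have "form K x (P y) = form K (P x) (P y)"
    using form_add_left[of "P x" "N x" "P y"] xy by (simp add: P_plus_N form_neg_pos)
  moreover have "form K x (N y) = form K (N x) (N y)"
    using form_add_left[of "P x" "N x" "N y"] xy by (simp add: P_plus_N form_pos_neg)
  moreover have "form K x y = form K x (P y) + form K x (N y)"
    using form_add_right[of "P y" "N y" x] xy by (simp add: P_plus_N)
  ultimately show ?thesis by simp
qed

lemma form_uminus_left: "x \<in> pts K \<Longrightarrow> y \<in> pts K \<Longrightarrow> form K (- x) y = - form K x y"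
  using form_scale_left[of x y "- 1"] by simp

lemma form_eq_hinner: "x \<in> pts K \<Longrightarrow> y \<in> pts K \<Longrightarrow> form K x y = hinner K (J x) y"
  using form_eq[of x y] by (simp add: hinner_def P_J N_J form_uminus_left)

lemma hnorm_sq_eq: "x \<in> pts K \<Longrightarrow> (hnorm K x)\<^sup>2 = (pos.nrm (P x))\<^sup>2 + (neg.nrm (N x))\<^sup>2"
  using pos.nrm_sq[of "P x"] neg.nrm_sq[of "N x"] nrm_sq[of x]
  by (simp add: hinner_def)

lemma nrm_P_le: "x \<in> pts K \<Longrightarrow> pos.nrm (P x) \<le> hnorm K x"
  and nrm_N_le: "x \<in> pts K \<Longrightarrow> neg.nrm (N x) \<le> hnorm K x"
  by (rule power2_le_imp_le; simp add: hnorm_sq_eq)+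

lemma hnorm_J: "x \<in> pts K \<Longrightarrow> hnorm K (J x) = hnorm K x"
proof -
  assume x: "x \<in> pts K"
  have "(hnorm K (J x))\<^sup>2 = (hnorm K x)\<^sup>2"
    using x by (simp add: hnorm_sq_eq P_J N_J neg.nrm_uminus)
  then show ?thesis using x by (simp add: power2_eq_iff_nonneg)
qed

lemma form_bound: "x \<in> pts K \<Longrightarrow> y \<in> pts K \<Longrightarrow> cmod (form K x y) \<le> hnorm K x * hnorm K y"
  using Cauchy_Schwarz[of "J x" y] by (simp add: form_eq_hinner hnorm_J)

text \<open>
  Pairing \<open>x\<close> with \<open>J x\<close> gives the squared Hilbert norm.
\<close>

lemma form_nondegenerate:
  assumes x: "x \<in> pts K" and 0: "\<And>y. y \<in> pts K \<Longrightarrow> form K x y = 0"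
  shows "x = 0"
proof -
  have "hinner K (J x) (J x) = 0" using 0[of "J x"] x by (simp add: form_eq_hinner)
  then have "hnorm K (J x) = 0" by (simp add: hnorm_def)
  then have "hnorm K x = 0" using x by (simp add: hnorm_J)
  then show ?thesis using x by (simp add: nrm_eq_0)
qed

lemma form_zero [simp]: "x \<in> pts K \<Longrightarrow> form K 0 x = 0" "x \<in> pts K \<Longrightarrow> form K x 0 = 0"
  using form_diff_left[of x x x] form_diff_right[of x x x] by simp_all

lemma form_ext:
  assumes "x \<in> pts K" "y \<in> pts K" and "\<And>z. z \<in> pts K \<Longrightarrow> form K x z = form K y z"
  shows "x = y"
  using form_nondegenerate[of "x - y"] assms by (simp add: form_diff_left)

lemma form_sum_left:
  "finite F \<Longrightarrow> (\<And>i. i \<in> F \<Longrightarrow> g i \<in> pts K) \<Longrightarrow> z \<in> pts K \<Longrightarrow>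
    form K (sum g F) z = (\<Sum>i\<in>F. form K (g i) z)"
  by (induction F rule: finite_induct) (simp_all add: form_add_left V_sum)

text \<open>
  The two components of a Cauchy sequence are Cauchy in the two Hilbert spaces of the
  decomposition, because the squared norm is the sum of the squared norms of the components.
\<close>

lemma complete: "mcomplete"
  unfolding mcomplete_def
proof (intro allI impI)
  fix \<sigma> assume \<sigma>: "MCauchy \<sigma>"
  then have in_pts: "\<sigma> n \<in> pts K" for n by (auto simp: MCauchy_def)
  have PN: "P (\<sigma> m - \<sigma> n) = P (\<sigma> m) - P (\<sigma> n)" "N (\<sigma> m - \<sigma> n) = N (\<sigma> m) - N (\<sigma> n)" for m n
    using P_add[of "\<sigma> m - \<sigma> n" "\<sigma> n"] N_add[of "\<sigma> m - \<sigma> n" "\<sigma> n"] in_pts by simp_all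
  have le: "pos.nrm (P (\<sigma> m) - P (\<sigma> n)) \<le> hnorm K (\<sigma> m - \<sigma> n)"
    "neg.nrm (N (\<sigma> m) - N (\<sigma> n)) \<le> hnorm K (\<sigma> m - \<sigma> n)" for m n
    using nrm_P_le[of "\<sigma> m - \<sigma> n"] nrm_N_le[of "\<sigma> m - \<sigma> n"] in_pts PN by auto
  have "pos.MCauchy (\<lambda>n. P (\<sigma> n))" "neg.MCauchy (\<lambda>n. N (\<sigma> n))"
    using \<sigma> le in_pts unfolding pos.MCauchy_def neg.MCauchy_def MCauchy_def
    by (simp_all add: image_subset_iff pos.form_dist_eq neg.form_dist_eq form_dist_eq)
       (meson le_less_trans)+
  moreover have "pos.mcomplete" "neg.mcomplete"
    using krein_space by (simp_all add: krein_space_def hilbert_on_def)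
  ultimately obtain a b where ab: "limitin pos.mtopology (\<lambda>n. P (\<sigma> n)) a sequentially"
      "limitin neg.mtopology (\<lambda>n. N (\<sigma> n)) b sequentially"
    unfolding pos.mcomplete_def neg.mcomplete_def by blast
  then have ab_in: "a \<in> pos K" "b \<in> neg K"
    and lim: "(\<lambda>n. pos.nrm (P (\<sigma> n) - a)) \<longlonglongrightarrow> 0" "(\<lambda>n. neg.nrm (N (\<sigma> n) - b)) \<longlonglongrightarrow> 0"
    using in_pts by (auto simp: pos.limitin_iff_nrm neg.limitin_iff_nrm)
  have "hnorm K (\<sigma> n - (a + b)) = sqrt ((pos.nrm (P (\<sigma> n) - a))\<^sup>2 + (neg.nrm (N (\<sigma> n) - b))\<^sup>2)" for n
  proof -
    have "\<sigma> n - (a + b) = (P (\<sigma> n) - a) + (N (\<sigma> n) - b)"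
      using P_plus_N[OF in_pts[of n]] by (metis add_diff_add)
    moreover have "P (\<sigma> n) - a \<in> pos K" "N (\<sigma> n) - b \<in> neg K"
      using ab_in in_pts by simp_all
    ultimately have "P (\<sigma> n - (a + b)) = P (\<sigma> n) - a" "N (\<sigma> n - (a + b)) = N (\<sigma> n) - b"
      using P_add_pos_neg N_add_pos_neg by metis+
    then have "(hnorm K (\<sigma> n - (a + b)))\<^sup>2 = (pos.nrm (P (\<sigma> n) - a))\<^sup>2 + (neg.nrm (N (\<sigma> n) - b))\<^sup>2"
      using ab_in in_pts by (simp add: hnorm_sq_eq)
    then show ?thesis 
      using ab_in in_pts nrm_nonneg[of "\<sigma> n - (a + b)"] by (simp add: real_sqrt_unique)
  qed
  moreover have "(\<lambda>n. sqrt ((pos.nrm (P (\<sigma> n) - a))\<^sup>2 + (neg.nrm (N (\<sigma> n) - b))\<^sup>2)) \<longlonglongrightarrow> sqrt (0\<^sup>2 + 0\<^sup>2)"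
    by (intro tendsto_intros lim)
  ultimately have "limitin mtopology \<sigma> (a + b) sequentially"
    using in_pts ab_in by (simp add: limitin_iff_nrm)
  then show "\<exists>x. limitin mtopology \<sigma> x sequentially" by blast
qed

text \<open>
  Continuity of the form in its first argument, from the Cauchy-Schwarz inequality \<open>form_bound\<close>.
\<close>

lemma form_tendsto:
  assumes "limitin (htopology K) g y F" "\<forall>\<^sub>F i in F. g i \<in> pts K" "z \<in> pts K"
  shows "((\<lambda>i. form K (g i) z) \<longlongrightarrow> form K y z) F"
proof -
  have y: "y \<in> pts K" and lim: "((\<lambda>i. hnorm K (g i - y)) \<longlongrightarrow> 0) F"
    using assms limitin_iff_nrm unfolding htopology_def by blast+
  have "((\<lambda>i. form K (g i) z - form K y z) \<longlongrightarrow> 0) F"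
  proof (rule Lim_null_comparison)
    show "\<forall>\<^sub>F i in F. norm (form K (g i) z - form K y z) \<le> hnorm K (g i - y) * hnorm K z"
      using assms(2)
      by (rule eventually_mono) (use y assms(3) in \<open>metis V_diff form_bound form_diff_left\<close>)
    show "((\<lambda>i. hnorm K (g i - y) * hnorm K z) \<longlongrightarrow> 0) F"
      by (rule tendsto_mult_left_zero[OF lim])
  qed
  then show ?thesis by (simp only: LIM_zero_iff)
qed

lemma has_usum_iff:
  assumes "\<And>i. i \<in> I \<Longrightarrow> g i \<in> pts K"
  shows "has_usum K g I y \<longleftrightarrow>
    y \<in> pts K \<and> ((\<lambda>F. hnorm K (sum g F - y)) \<longlongrightarrow> 0) (finite_subsets_at_top I)"
  unfolding has_usum_def htopology_def
proof (rule limitin_iff_nrm)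
  show "\<forall>\<^sub>F F in finite_subsets_at_top I. sum g F \<in> pts K"
    by (rule eventually_finite_subsets_at_top_weakI) (use assms in \<open>blast intro: V_sum\<close>)
qed

text \<open>
  An unconditional sum may be paired with a vector term by term. Together with nondegeneracy this
  allows identities between vectors to be proved as identities between numerical sums.
\<close>

lemma has_usum_form:
  assumes "has_usum K g I y" "\<And>i. i \<in> I \<Longrightarrow> g i \<in> pts K" "z \<in> pts K"
  shows "((\<lambda>i. form K (g i) z) has_sum form K y z) I"
proof -
  have ev: "\<forall>\<^sub>F F in finite_subsets_at_top I. finite F \<and> F \<subseteq> I"
    by (simp add: eventually_finite_subsets_at_top_weakI)
  have "((\<lambda>F. form K (sum g F) z) \<longlongrightarrow> form K y z) (finite_subsets_at_top I)"
    using assms(1) unfolding has_usum_def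
    by (rule form_tendsto)
       (use ev in \<open>rule eventually_mono, auto intro!: V_sum assms(2) assms(3)\<close>)
  moreover have "\<forall>\<^sub>F F in finite_subsets_at_top I. form K (sum g F) z = (\<Sum>i\<in>F. form K (g i) z)"
    using ev by (rule eventually_mono) (use assms in \<open>auto intro!: form_sum_left\<close>)
  ultimately show ?thesis
    unfolding has_sum_def by (rule Lim_transform_eventually)
qed

lemma closedin_form_compl:
  assumes "S \<subseteq> pts K"
  shows "closedin (htopology K) (form_compl K S)"
  unfolding htopology_def metric_closedin_iff_sequentially_closed
proof (intro conjI allI impI)
  show "form_compl K S \<subseteq> pts K" by (auto simp: form_compl_def)
  fix \<sigma> l assume *: "range \<sigma> \<subseteq> form_compl K S \<and> limitin mtopology \<sigma> l sequentially"
  then have in_pts: "\<sigma> n \<in> pts K" and 0: "z \<in> S \<Longrightarrow> form K (\<sigma> n) z = 0" for n z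
    by (auto simp: form_compl_def)
  have "form K l z = 0" if "z \<in> S" for z
    using form_tendsto[of \<sigma> l sequentially z] * in_pts assms that
    by (auto simp: htopology_def 0 tendsto_const_iff)
  then show "l \<in> form_compl K S"
    using * limitin_mspace by (auto simp: form_compl_def)
qed

text \<open>
  If \<open>x\<close> is orthogonal to the complement of \<open>S\<close> and \<open>x = s + n\<close>, then \<open>n\<close> is orthogonal to \<open>S\<close>
  and to the complement of \<open>S\<close>, hence to the whole space.
\<close>

lemma form_compl_form_compl:
  assumes S: "subspace_of K S" and sum: "direct_sum (pts K) S (form_compl K S)"
  shows "form_compl K (form_compl K S) = S"
proof
  have S_pts: "S \<subseteq> pts K" using S by (simp add: subspace_of_def)
  show "S \<subseteq> form_compl K (form_compl K S)"
  proof
    fix x assume x: "x \<in> S"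
    then have "form K x y = 0" if "y \<in> form_compl K S" for y
      using that S_pts form_commute[of y x] by (auto simp: form_compl_def)
    then show "x \<in> form_compl K (form_compl K S)" using x S_pts by (auto simp: form_compl_def)
  qed
  show "form_compl K (form_compl K S) \<subseteq> S"
  proof
    fix x assume x: "x \<in> form_compl K (form_compl K S)"
    then have x_pts: "x \<in> pts K" by (simp add: form_compl_def)
    then obtain s n where s: "s \<in> S" and n: "n \<in> form_compl K S" and x_eq: "x = s + n"
      using sum by (auto simp: direct_sum_def)
    have n_pts: "n \<in> pts K" using n by (simp add: form_compl_def)
    have "form K n z = 0" if z: "z \<in> pts K" for z
    proof -
      obtain s' n' where s': "s' \<in> S" and n': "n' \<in> form_compl K S" and z_eq: "z = s' + n'"
        using z sum by (auto simp: direct_sum_def)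
      have n'_pts: "n' \<in> pts K" using n' by (simp add: form_compl_def)
      have "form K n' s = 0" using n' s by (simp add: form_compl_def)
      then have "form K s n' = 0" using form_commute[of n' s] n'_pts s S_pts by auto
      moreover have "form K x n' = 0" using x n' by (simp add: form_compl_def)
      ultimately have "form K n n' = 0"
        using form_add_left[of s n n'] s S_pts n_pts n'_pts by (auto simp: x_eq)
      moreover have "form K n s' = 0" using n s' by (simp add: form_compl_def)
      ultimately show ?thesis
        using form_add_right[of s' n' n] s' S_pts n_pts n'_pts by (auto simp: z_eq)
    qed
    then have "n = 0" by (rule form_nondegenerate[OF n_pts])
    then show "x \<in> S" using x_eq s by simp
  qed
qed

text \<open>
  Closedness comes for free: \<open>S\<close> is its own double complement, and complements are closed.
\<close>

lemma regular_subspaceI: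
  assumes "subspace_of K S" "direct_sum (pts K) S (form_compl K S)"
  shows "regular_subspace K S"
proof -
  have "closedin (htopology K) (form_compl K (form_compl K S))"
    by (rule closedin_form_compl) (auto simp: form_compl_def)
  then show ?thesis using assms by (simp add: regular_subspace_def form_compl_form_compl)
qed

lemma unif_pos_neg_Int:
  assumes "unif_pos K S" "unif_neg K R" "x \<in> S" "x \<in> R"
  shows "x = 0"
proof -
  obtain a where a: "a > 0" "Re (form K x x) \<ge> a * (hnorm K x)\<^sup>2"
    using assms by (auto simp: unif_pos_def)
  obtain b where b: "b > 0" "- Re (form K x x) \<ge> b * (hnorm K x)\<^sup>2"
    using assms by (auto simp: unif_neg_def)
  have "(a + b) * (hnorm K x)\<^sup>2 \<le> 0" using a b by (simp add: distrib_right)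
  then have "hnorm K x = 0" using a(1) b(1) by (simp add: mult_le_0_iff)
  moreover have "x \<in> pts K" using assms by (auto simp: unif_pos_def subspace_of_def)
  ultimately show ?thesis by (simp add: nrm_eq_0)
qed

text \<open>
  A larger uniformly positive subspace \<open>S'\<close> contains the \<open>R\<close>-component of each of its vectors, and
  this component is both positive and negative, hence zero.
\<close>

lemma maximal_unif_decomposition:
  assumes S: "unif_pos K S" and R: "unif_neg K R"
    and sum: "\<And>x. x \<in> pts K \<Longrightarrow> \<exists>s\<in>S. \<exists>r\<in>R. x = s + r"
  shows "maximal_unif_pos K S" and "maximal_unif_neg K R"
proof -
  have "S' \<subseteq> S" if S': "unif_pos K S'" "S \<subseteq> S'" for S'
  proof
    fix x assume x: "x \<in> S'"
    then have "x \<in> pts K" using S' by (auto simp: unif_pos_def subspace_of_def)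
    then obtain s r where sr: "s \<in> S" "r \<in> R" "x = s + r" using sum by blast
    have "x - s \<in> S'"
      using S' sr(1) x by (intro subspace_diff) (auto simp: unif_pos_def subspace_of_def)
    then have "r = 0" using unif_pos_neg_Int[OF S'(1) R _ sr(2)] sr(3) by simp
    then show "x \<in> S" using sr by simp
  qed
  then show "maximal_unif_pos K S" using S by (auto simp: maximal_unif_pos_def)
  have "R' \<subseteq> R" if R': "unif_neg K R'" "R \<subseteq> R'" for R'
  proof
    fix x assume x: "x \<in> R'"
    then have "x \<in> pts K" using R' by (auto simp: unif_neg_def subspace_of_def)
    then obtain s r where sr: "s \<in> S" "r \<in> R" "x = s + r" using sum by blast
    have "x - r \<in> R'"
      using R' sr(2) x by (intro subspace_diff) (auto simp: unif_neg_def subspace_of_def)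
    then have "s = 0" using unif_pos_neg_Int[OF S R'(1) sr(1)] sr(3) by simp
    then show "x \<in> R" using sr by simp
  qed
  then show "maximal_unif_neg K R" using R by (auto simp: maximal_unif_neg_def)
qed

end

section \<open>The Krein space of square summable families\<close>

definition cscale :: "complex \<Rightarrow> ('i \<Rightarrow> complex) \<Rightarrow> 'i \<Rightarrow> complex" where
  "cscale c x = (\<lambda>i. c * x i)"

lemma cscale_apply [simp]: "cscale c x i = c * x i"
  by (simp add: cscale_def)

definition ell2_inner :: "'i set \<Rightarrow> ('i \<Rightarrow> complex) \<Rightarrow> ('i \<Rightarrow> complex) \<Rightarrow> complex" where
  "ell2_inner A x y = (\<Sum>\<^sub>\<infinity>i\<in>A. x i * cnj (y i))"

lemma ell2_form_eq: "ell2_form A B x y = ell2_inner A x y - ell2_inner B x y"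
  by (simp add: ell2_form_def ell2_inner_def)

lemma ell2_outside: "x \<in> ell2 I \<Longrightarrow> i \<notin> I \<Longrightarrow> x i = 0"
  and ell2_summable: "x \<in> ell2 I \<Longrightarrow> (\<lambda>i. (cmod (x i))\<^sup>2) summable_on I"
  by (auto simp: ell2_def)

lemma ell2_mono: "x \<in> ell2 A \<Longrightarrow> A \<subseteq> I \<Longrightarrow> x \<in> ell2 I"
  using summable_on_cong_neutral[of I A "\<lambda>i. (cmod (x i))\<^sup>2" "\<lambda>i. (cmod (x i))\<^sup>2"]
  by (auto simp: ell2_def)

lemma ell2_summable_product:
  assumes "x \<in> ell2 I" "y \<in> ell2 I" "A \<subseteq> I"
  shows "(\<lambda>i. x i * cnj (y i)) summable_on A"
proof -
  have "(\<lambda>i. norm (x i * cnj (y i))) summable_on I"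
    using ell2_summable[OF assms(1)] ell2_summable[OF assms(2)]
    by (intro abs_summable_product[of x I "\<lambda>i. cnj (y i)"]) (simp_all add: norm_mult power2_eq_square)
  then show ?thesis
    by (rule summable_on_subset_banach[OF abs_summable_summable assms(3)])
qed

lemma ell2_add: "x \<in> ell2 I \<Longrightarrow> y \<in> ell2 I \<Longrightarrow> x + y \<in> ell2 I"
proof -
  assume x: "x \<in> ell2 I" and y: "y \<in> ell2 I"
  have "(\<lambda>i. 2 * (cmod (x i))\<^sup>2 + 2 * (cmod (y i))\<^sup>2) summable_on I"
    by (intro summable_on_add summable_on_cmult_right ell2_summable x y)
  then have "(\<lambda>i. (cmod (x i + y i))\<^sup>2) summable_on I"
  proof (rule summable_on_comparison_test)
    fix i
    have "(cmod (x i + y i))\<^sup>2 \<le> (cmod (x i) + cmod (y i))\<^sup>2"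
      by (intro power_mono norm_triangle_ineq) simp
    also have "\<dots> \<le> 2 * (cmod (x i))\<^sup>2 + 2 * (cmod (y i))\<^sup>2"
      using sum_squares_bound[of "cmod (x i)" "cmod (y i)"] by (simp add: power2_sum)
    finally show "(cmod (x i + y i))\<^sup>2 \<le> 2 * (cmod (x i))\<^sup>2 + 2 * (cmod (y i))\<^sup>2" .
  qed simp
  then show ?thesis using x y by (simp add: ell2_def)
qed

lemma ell2_scale: "x \<in> ell2 I \<Longrightarrow> cscale c x \<in> ell2 I"
  by (simp add: ell2_def norm_mult power_mult_distrib summable_on_cmult_right)

lemma ell2_zero: "0 \<in> ell2 I"
  by (simp add: ell2_def)

lemma vector_space_cscale: "vector_space cscale"
  by unfold_locales (auto simp: fun_eq_iff algebra_simps)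

lemma subspace_ell2: "module.subspace cscale (ell2 I)"
proof -
  interpret vector_space cscale by (rule vector_space_cscale)
  show ?thesis by (simp add: subspace_def ell2_add ell2_scale ell2_zero)
qed

lemma ell2_inner_hermitian: "A \<subseteq> I \<Longrightarrow> hermitian_on cscale (ell2 I) (ell2_inner A)"
  unfolding hermitian_on_def ell2_inner_def
proof (intro conjI ballI allI)
  fix x y z :: "'a \<Rightarrow> complex" and c
  assume *: "A \<subseteq> I" "x \<in> ell2 I" "y \<in> ell2 I"
  show "(\<Sum>\<^sub>\<infinity>i\<in>A. y i * cnj (x i)) = cnj (\<Sum>\<^sub>\<infinity>i\<in>A. x i * cnj (y i))"
    by (simp add: mult.commute flip: infsum_cnj)
  show "(\<Sum>\<^sub>\<infinity>i\<in>A. cscale c x i * cnj (y i)) = c * (\<Sum>\<^sub>\<infinity>i\<in>A. x i * cnj (y i))"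
    using * by (simp add: mult.assoc infsum_cmult_right ell2_summable_product)
  assume "z \<in> ell2 I"
  then show "(\<Sum>\<^sub>\<infinity>i\<in>A. (x + y) i * cnj (z i)) =
      (\<Sum>\<^sub>\<infinity>i\<in>A. x i * cnj (z i)) + (\<Sum>\<^sub>\<infinity>i\<in>A. y i * cnj (z i))"
    using * by (simp add: distrib_right infsum_add ell2_summable_product)
qed

lemma ell2_inner_self: "x \<in> ell2 A \<Longrightarrow> ell2_inner A x x = complex_of_real (\<Sum>\<^sub>\<infinity>i\<in>A. (cmod (x i))\<^sup>2)"
proof -
  assume "x \<in> ell2 A"
  then have "((\<lambda>i. complex_of_real ((cmod (x i))\<^sup>2)) has_sum
      complex_of_real (\<Sum>\<^sub>\<infinity>i\<in>A. (cmod (x i))\<^sup>2)) A"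
    unfolding has_sum_of_real_iff by (intro has_sum_infsum ell2_summable)
  then show ?thesis
    unfolding ell2_inner_def complex_norm_square[symmetric] by (rule infsumI)
qed

interpretation ell2: inner_product_on cscale "ell2 A" "ell2_inner A" for A :: "'i set"
proof (intro inner_product_on.intro inner_product_on_axioms.intro vector_space_cscale
    subspace_ell2 ell2_inner_hermitian order_refl)
  fix x :: "'i \<Rightarrow> complex"
  assume x: "x \<in> ell2 A" "x \<noteq> 0"
  then obtain i where i: "i \<in> A" "x i \<noteq> 0" by (auto simp: fun_eq_iff ell2_def)
  have "0 < (\<Sum>j\<in>{i}. (cmod (x j))\<^sup>2)" using i by simp
  also have "\<dots> \<le> (\<Sum>\<^sub>\<infinity>i\<in>A. (cmod (x i))\<^sup>2)"
    using i x by (intro finite_sum_le_infsum ell2_summable) auto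
  finally show "0 < Re (ell2_inner A x x)" using x by (simp add: ell2_inner_self)
qed

lemma ell2_nrm_sq: "x \<in> ell2 A \<Longrightarrow> (ell2.nrm A x)\<^sup>2 = (\<Sum>\<^sub>\<infinity>i\<in>A. (cmod (x i))\<^sup>2)"
  by (simp add: ell2.nrm_def ell2_inner_self infsum_nonneg)

lemma ell2_cmod_le_nrm: "x \<in> ell2 A \<Longrightarrow> cmod (x i) \<le> ell2.nrm A x"
proof (cases "i \<in> A")
  case True
  assume x: "x \<in> ell2 A"
  have "(\<Sum>j\<in>{i}. (cmod (x j))\<^sup>2) \<le> (ell2.nrm A x)\<^sup>2"
    unfolding ell2_nrm_sq[OF x] using True x by (intro finite_sum_le_infsum ell2_summable) auto
  then show ?thesis using power2_le_imp_le[OF _ ell2.nrm_nonneg[OF x]] by simp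
qed (simp add: ell2_outside)

text \<open>
  Bounds on finite partial sums pass to coordinatewise limits; this is how limits of sequences in
  \<open>ell2\<close> are shown to belong to it.
\<close>

lemma ell2I_finite_sums:
  assumes "\<And>i. i \<notin> A \<Longrightarrow> x i = 0"
    and "\<And>F. finite F \<Longrightarrow> F \<subseteq> A \<Longrightarrow> (\<Sum>i\<in>F. (cmod (x i))\<^sup>2) \<le> c\<^sup>2" and "0 \<le> c"
  shows "x \<in> ell2 A" and "ell2.nrm A x \<le> c"
proof -
  have "(\<lambda>i. (cmod (x i))\<^sup>2) summable_on A"
    using assms(2) by (intro nonneg_bdd_above_summable_on bdd_aboveI2[of _ _ "c\<^sup>2"]) auto
  then show x: "x \<in> ell2 A" using assms(1) by (simp add: ell2_def)
  have "(ell2.nrm A x)\<^sup>2 \<le> c\<^sup>2"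
    unfolding ell2_nrm_sq[OF x] by (intro infsum_le_finite_sums ell2_summable x assms(2))
  then show "ell2.nrm A x \<le> c" using assms(3) by (rule power2_le_imp_le)
qed

text \<open>
  A Cauchy sequence converges in each coordinate. Letting one index tend to infinity in the
  finite partial sums of \<open>\<parallel>\<sigma> n - \<sigma> m\<parallel>\<^sup>2\<close> shows that the coordinatewise limit is also the limit in norm.
\<close>

lemma ell2_complete: "Metric_space.mcomplete (ell2 A) (form_dist (ell2 A) (ell2_inner A))"
  unfolding ell2.mcomplete_def
proof (intro allI impI)
  fix \<sigma> assume \<sigma>: "ell2.MCauchy A \<sigma>"
  then have \<sigma>_in: "\<sigma> n \<in> ell2 A" for n by (auto simp: ell2.MCauchy_def)
  have cauchy: "\<exists>N. \<forall>m\<ge>N. \<forall>n\<ge>N. ell2.nrm A (\<sigma> m - \<sigma> n) < e" if "e > 0" for e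
    using \<sigma> that \<sigma>_in unfolding ell2.MCauchy_def by (simp add: ell2.form_dist_eq)
  have "\<exists>l. (\<lambda>n. \<sigma> n i) \<longlonglongrightarrow> l" for i
  proof -
    have "Cauchy (\<lambda>n. \<sigma> n i)"
    proof (rule metric_CauchyI)
      fix e :: real assume "0 < e"
      then obtain N where N: "\<forall>m\<ge>N. \<forall>n\<ge>N. ell2.nrm A (\<sigma> m - \<sigma> n) < e" using cauchy by blast
      have "dist (\<sigma> m i) (\<sigma> n i) \<le> ell2.nrm A (\<sigma> m - \<sigma> n)" for m n
        using ell2_cmod_le_nrm[of "\<sigma> m - \<sigma> n" A i] \<sigma>_in by (simp add: dist_norm)
      then show "\<exists>N. \<forall>m\<ge>N. \<forall>n\<ge>N. dist (\<sigma> m i) (\<sigma> n i) < e"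
        using N le_less_trans by metis
    qed
    then show ?thesis by (simp add: Cauchy_convergent_iff convergent_def)
  qed
  then obtain x where x: "\<And>i. (\<lambda>n. \<sigma> n i) \<longlonglongrightarrow> x i" by metis
  have x_out: "x i = 0" if "i \<notin> A" for i
    using LIMSEQ_unique[OF x[of i], of 0] ell2_outside[OF \<sigma>_in that] by simp
  have tail: "\<sigma> n - x \<in> ell2 A \<and> ell2.nrm A (\<sigma> n - x) \<le> e"
    if N: "\<forall>m\<ge>N. \<forall>n\<ge>N. ell2.nrm A (\<sigma> m - \<sigma> n) < e" and n: "n \<ge> N" and e: "0 < e" for N n e
  proof -
    have "(\<Sum>i\<in>F. (cmod ((\<sigma> n - x) i))\<^sup>2) \<le> e\<^sup>2" if F: "finite F" "F \<subseteq> A" for F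
    proof (rule tendsto_upperbound)
      show "(\<lambda>m. \<Sum>i\<in>F. (cmod ((\<sigma> n - \<sigma> m) i))\<^sup>2) \<longlonglongrightarrow> (\<Sum>i\<in>F. (cmod ((\<sigma> n - x) i))\<^sup>2)"
        by (auto intro!: tendsto_intros x)
      have "(\<Sum>i\<in>F. (cmod ((\<sigma> n - \<sigma> m) i))\<^sup>2) \<le> e\<^sup>2" if "m \<ge> N" for m
      proof -
        have "(\<Sum>i\<in>F. (cmod ((\<sigma> n - \<sigma> m) i))\<^sup>2) \<le> (ell2.nrm A (\<sigma> n - \<sigma> m))\<^sup>2"
          unfolding ell2_nrm_sq[OF ell2.V_diff[OF \<sigma>_in \<sigma>_in]] using F
          by (intro finite_sum_le_infsum ell2_summable ell2.V_diff \<sigma>_in) simp_all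
        also have "\<dots> \<le> e\<^sup>2"
          using N n that \<sigma>_in by (intro power_mono) (auto intro: less_imp_le)
        finally show ?thesis .
      qed
      then show "\<forall>\<^sub>F m in sequentially. (\<Sum>i\<in>F. (cmod ((\<sigma> n - \<sigma> m) i))\<^sup>2) \<le> e\<^sup>2"
        by (rule eventually_sequentiallyI)
    qed simp
    then show ?thesis
      using ell2I_finite_sums[of A "\<sigma> n - x" e] x_out ell2_outside[OF \<sigma>_in[of n]] e by simp
  qed
  obtain N where "\<forall>m\<ge>N. \<forall>n\<ge>N. ell2.nrm A (\<sigma> m - \<sigma> n) < 1" using cauchy[of 1] by auto
  then have "\<sigma> N - x \<in> ell2 A" using tail[of N 1 N] by simp
  then have x_in: "x \<in> ell2 A" using ell2.V_diff[OF \<sigma>_in[of N], of "\<sigma> N - x"] by simp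
  have "limitin (ell2.mtopology A) \<sigma> x sequentially"
    unfolding ell2.limitin_metric
  proof (intro conjI allI impI x_in)
    fix e :: real assume "0 < e"
    then obtain N where N: "\<forall>m\<ge>N. \<forall>n\<ge>N. ell2.nrm A (\<sigma> m - \<sigma> n) < e / 2"
      using cauchy half_gt_zero by blast
    have "\<sigma> n \<in> ell2 A \<and> form_dist (ell2 A) (ell2_inner A) (\<sigma> n) x < e" if "n \<ge> N" for n
      using tail[OF N that] \<open>0 < e\<close> \<sigma>_in x_in by (simp add: ell2.form_dist_eq)
    then show "\<forall>\<^sub>F n in sequentially. \<sigma> n \<in> ell2 A \<and> form_dist (ell2 A) (ell2_inner A) (\<sigma> n) x < e"
      by (rule eventually_sequentiallyI)
  qed
  then show "\<exists>x. limitin (ell2.mtopology A) \<sigma> x sequentially" by blast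
qed

text \<open>
  Stated for any form that agrees with the inner product on \<open>ell2 A\<close>, as the indefinite form does on
  either part of the decomposition.
\<close>

lemma hilbert_on_ell2:
  assumes "\<And>x y. x \<in> ell2 A \<Longrightarrow> y \<in> ell2 A \<Longrightarrow> q x y = ell2_inner A x y"
  shows "hilbert_on cscale (ell2 A) q"
proof -
  have "hermitian_on cscale (ell2 A) q"
    using ell2.herm[of A] ell2.V_add ell2.V_scale assms unfolding hermitian_on_def
    by (metis (no_types, lifting))
  moreover have "form_dist (ell2 A) q = form_dist (ell2 A) (ell2_inner A)"
    using assms by (auto simp: form_dist_def fun_eq_iff)
  ultimately show ?thesis
    using ell2.subspace_V[of A] ell2.pos_def[of _ A] ell2_complete[of A] assms
    by (simp add: hilbert_on_def)
qed

lemma ell2_restrict_in: "x \<in> ell2 I \<Longrightarrow> A \<subseteq> I \<Longrightarrow> ell2_restrict A x \<in> ell2 A"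
proof -
  assume x: "x \<in> ell2 I" and A: "A \<subseteq> I"
  have "(\<lambda>i. (cmod (ell2_restrict A x i))\<^sup>2) summable_on A \<longleftrightarrow> (\<lambda>i. (cmod (x i))\<^sup>2) summable_on A"
    by (rule summable_on_cong) (simp add: ell2_restrict_def)
  then have "(\<lambda>i. (cmod (ell2_restrict A x i))\<^sup>2) summable_on A"
    using summable_on_subset_banach[OF ell2_summable[OF x] A] by simp
  then show ?thesis by (simp add: ell2_def ell2_restrict_def)
qed

lemma ell2_restrict_add:
  "x \<in> ell2 (A \<union> B) \<Longrightarrow> A \<inter> B = {} \<Longrightarrow> ell2_restrict A x + ell2_restrict B x = x"
  using ell2_outside[of x "A \<union> B"] by (auto simp: ell2_restrict_def fun_eq_iff)

lemma ell2_restrict_id: "x \<in> ell2 A \<Longrightarrow> ell2_restrict A x = x"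
  using ell2_outside[of x A] by (auto simp: ell2_restrict_def fun_eq_iff)

definition ell2_krein :: "'i set \<Rightarrow> 'i set \<Rightarrow> ('i \<Rightarrow> complex) krein" where
  "ell2_krein A B = \<lparr>scl = cscale, pts = ell2 (A \<union> B), form = ell2_form A B,
     pos = ell2 A, neg = ell2 B\<rparr>"

lemma ell2_krein_simps [simp]:
  "scl (ell2_krein A B) = cscale" "pts (ell2_krein A B) = ell2 (A \<union> B)"
  "form (ell2_krein A B) = ell2_form A B" "pos (ell2_krein A B) = ell2 A"
  "neg (ell2_krein A B) = ell2 B"
  by (simp_all add: ell2_krein_def)

lemma ell2_inner_outside:
  "A \<inter> B = {} \<Longrightarrow> x \<in> ell2 B \<Longrightarrow> ell2_inner A x y = 0"
  "A \<inter> B = {} \<Longrightarrow> y \<in> ell2 B \<Longrightarrow> ell2_inner A x y = 0"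
proof -
  assume AB: "A \<inter> B = {}"
  show "ell2_inner A x y = 0" if "x \<in> ell2 B"
    unfolding ell2_inner_def
  proof (rule infsum_0)
    fix i assume "i \<in> A"
    then have "x i = 0" using AB ell2_outside[OF that] by blast
    then show "x i * cnj (y i) = 0" by simp
  qed
  show "ell2_inner A x y = 0" if "y \<in> ell2 B"
    unfolding ell2_inner_def
  proof (rule infsum_0)
    fix i assume "i \<in> A"
    then have "y i = 0" using AB ell2_outside[OF that] by blast
    then show "x i * cnj (y i) = 0" by simp
  qed
qed

lemma hermitian_on_diff:
  assumes "hermitian_on s V q" "hermitian_on s V r"
  shows "hermitian_on s V (\<lambda>x y. q x y - r x y)"
  unfolding hermitian_on_def
proof (intro conjI ballI allI)
  fix x y z c assume "x \<in> V" "y \<in> V"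
  then show "q y x - r y x = cnj (q x y - r x y)"
    using assms unfolding hermitian_on_def by (metis complex_cnj_diff)
  show "q (s c x) y - r (s c x) y = c * (q x y - r x y)"
    using assms \<open>x \<in> V\<close> \<open>y \<in> V\<close> unfolding hermitian_on_def by (metis right_diff_distrib)
  assume "z \<in> V"
  then show "q (x + y) z - r (x + y) z = q x z - r x z + (q y z - r y z)"
    using assms \<open>x \<in> V\<close> \<open>y \<in> V\<close> unfolding hermitian_on_def by (metis add_diff_add)
qed

lemma krein_space_ell2:
  assumes AB: "A \<inter> B = {}"
  shows "krein_space (ell2_krein A B)"
  unfolding krein_space_def ell2_krein_simps
proof (intro conjI)
  have BA: "B \<inter> A = {}" using AB by blast
  show "hermitian_on cscale (ell2 (A \<union> B)) (ell2_form A B)"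
    unfolding ell2_form_eq [abs_def]
    by (intro hermitian_on_diff ell2_inner_hermitian Un_upper1 Un_upper2)
  have "x \<in> {a + b |a b. a \<in> ell2 A \<and> b \<in> ell2 B}" if "x \<in> ell2 (A \<union> B)" for x
    using ell2_restrict_add[OF that AB, symmetric] ell2_restrict_in[OF that Un_upper1]
      ell2_restrict_in[OF that Un_upper2] by (intro CollectI exI conjI)
  moreover have "a + b \<in> ell2 (A \<union> B)" if "a \<in> ell2 A" "b \<in> ell2 B" for a b
    using that by (intro ell2_add) (auto intro: ell2_mono)
  moreover have "a = 0" if "a \<in> ell2 A" "a \<in> ell2 B" for a
  proof
    fix i show "a i = 0 i"
      using AB ell2_outside[OF that(1), of i] ell2_outside[OF that(2), of i] by auto
  qed
  ultimately show "direct_sum (ell2 (A \<union> B)) (ell2 A) (ell2 B)"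
    by (auto simp: direct_sum_def ell2_zero)
  show "\<forall>x\<in>ell2 A. \<forall>y\<in>ell2 B. ell2_form A B x y = 0"
    by (simp add: ell2_form_eq ell2_inner_outside(2)[OF AB] ell2_inner_outside(1)[OF BA])
  show "hilbert_on cscale (ell2 A) (ell2_form A B)"
    by (rule hilbert_on_ell2) (simp add: ell2_form_eq ell2_inner_outside(1)[OF BA])
  show "hilbert_on cscale (ell2 B) (\<lambda>x y. - ell2_form A B x y)"
    by (rule hilbert_on_ell2) (simp add: ell2_form_eq ell2_inner_outside(1)[OF AB])
qed (simp_all add: vector_space_cscale subspace_ell2)

lemma hinner_ell2:
  assumes AB: "A \<inter> B = {}" and x: "x \<in> ell2 (A \<union> B)" and y: "y \<in> ell2 (A \<union> B)"
  shows "hinner (ell2_krein A B) x y = ell2_inner (A \<union> B) x y"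
proof -
  interpret krein "ell2_krein A B" by unfold_locales (rule krein_space_ell2[OF AB])
  have BA: "B \<inter> A = {}" using AB by blast
  have PN: "P z = ell2_restrict A z" "N z = ell2_restrict B z" if "z \<in> ell2 (A \<union> B)" for z
    using P_add_pos_neg[of "ell2_restrict A z" "ell2_restrict B z"]
      N_add_pos_neg[of "ell2_restrict A z" "ell2_restrict B z"] that
    by (simp_all add: ell2_restrict_in ell2_restrict_add AB)
  have "ell2_inner C (ell2_restrict C x) (ell2_restrict C y) = ell2_inner C x y" for C
    unfolding ell2_inner_def by (rule infsum_cong) (simp add: ell2_restrict_def)
  then have "ell2_form A B (ell2_restrict A x) (ell2_restrict A y) = ell2_inner A x y"
    "ell2_form A B (ell2_restrict B x) (ell2_restrict B y) = - ell2_inner B x y"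
    using ell2_inner_outside(1)[OF AB ell2_restrict_in[OF x Un_upper2]]
      ell2_inner_outside(1)[OF BA ell2_restrict_in[OF x Un_upper1]]
    by (simp_all add: ell2_form_eq)
  moreover have "ell2_inner (A \<union> B) x y = ell2_inner A x y + ell2_inner B x y"
    unfolding ell2_inner_def
    by (intro infsum_Un_disjoint ell2_summable_product[OF x y] AB) auto
  ultimately show ?thesis
    using PN x y by (simp add: hinner_def)
qed

lemma hnorm_ell2_sq:
  assumes "A \<inter> B = {}" "x \<in> ell2 (A \<union> B)"
  shows "(hnorm (ell2_krein A B) x)\<^sup>2 = (\<Sum>\<^sub>\<infinity>i\<in>A \<union> B. (cmod (x i))\<^sup>2)"
  using assms by (simp add: hnorm_def hinner_ell2 ell2_inner_self infsum_nonneg)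

definition ell2_unit :: "'i \<Rightarrow> 'i \<Rightarrow> complex" where
  "ell2_unit i = (\<lambda>j. if j = i then 1 else 0)"

lemma infsum_single:
  assumes "i \<in> I" "\<And>j. j \<in> I \<Longrightarrow> j \<noteq> i \<Longrightarrow> g j = 0"
  shows "infsum g I = g i"
proof -
  have "infsum g I = infsum g {i}" by (rule infsum_cong_neutral) (use assms in auto)
  then show ?thesis by simp
qed

lemma ell2_finite: "finite F \<Longrightarrow> F \<subseteq> I \<Longrightarrow> (\<And>i. i \<notin> F \<Longrightarrow> x i = 0) \<Longrightarrow> x \<in> ell2 I"
  by (rule ell2_mono[of _ F]) (simp_all add: ell2_def)

lemma ell2_unit_in: "i \<in> I \<Longrightarrow> ell2_unit i \<in> ell2 I"
  by (rule ell2_finite[of "{i}"]) (auto simp: ell2_unit_def)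

lemma ell2_inner_unit: "ell2_inner A x (ell2_unit i) = (if i \<in> A then x i else 0)"
proof (cases "i \<in> A")
  case True
  then show ?thesis
    unfolding ell2_inner_def by (subst infsum_single[of i]) (auto simp: ell2_unit_def)
next
  case False
  then have "ell2_inner A x (ell2_unit i) = 0"
    unfolding ell2_inner_def by (intro infsum_0) (auto simp: ell2_unit_def)
  with False show ?thesis by simp
qed

text \<open>
  The squared distance of \<open>x\<close> to the partial sum over \<open>F\<close> is the sum of \<open>\<bar>x i\<bar>\<^sup>2\<close> outside \<open>F\<close>.
\<close>

lemma ell2_unit_expansion:
  assumes AB: "A \<inter> B = {}" and x: "x \<in> ell2 (A \<union> B)"
  shows "has_usum (ell2_krein A B) (\<lambda>i. cscale (x i) (ell2_unit i)) (A \<union> B) x"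
proof -
  interpret krein "ell2_krein A B" by unfold_locales (rule krein_space_ell2[OF AB])
  let ?I = "A \<union> B" and ?g = "\<lambda>i. cscale (x i) (ell2_unit i)"
  let ?S = "\<Sum>\<^sub>\<infinity>i\<in>?I. (cmod (x i))\<^sup>2"
  have sum_eq: "sum ?g F = ell2_restrict F x" if "finite F" for F
    using that
    by (induction F rule: finite_induct)
       (auto simp: fun_eq_iff ell2_restrict_def ell2_unit_def)
  have ev: "\<forall>\<^sub>F F in finite_subsets_at_top ?I. finite F \<and> F \<subseteq> ?I"
    by (simp add: eventually_finite_subsets_at_top_weakI)
  have in_pts: "sum ?g F \<in> ell2 ?I" if "finite F" "F \<subseteq> ?I" for F
    using that ell2_mono[OF ell2_restrict_in[OF x that(2)] that(2)] by (simp add: sum_eq)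
  have norm_eq: "hnorm (ell2_krein A B) (sum ?g F - x) = sqrt (?S - (\<Sum>i\<in>F. (cmod (x i))\<^sup>2))"
    if F: "finite F" "F \<subseteq> ?I" for F
  proof -
    have "(hnorm (ell2_krein A B) (sum ?g F - x))\<^sup>2 = (\<Sum>\<^sub>\<infinity>i\<in>?I. (cmod ((sum ?g F - x) i))\<^sup>2)"
      using in_pts[OF F] x by (intro hnorm_ell2_sq AB ell2.V_diff)
    also have "\<dots> = (\<Sum>\<^sub>\<infinity>i\<in>?I - F. (cmod (x i))\<^sup>2)"
      by (intro infsum_cong_neutral) (auto simp: sum_eq[OF F(1)] ell2_restrict_def)
    also have "\<dots> = ?S - (\<Sum>i\<in>F. (cmod (x i))\<^sup>2)"
      using F infsum_Diff[of "\<lambda>i. (cmod (x i))\<^sup>2" ?I F] ell2_summable[OF x] by simp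
    finally show ?thesis
      using nrm_nonneg[of "sum ?g F - x"] in_pts[OF F] x ell2.V_diff by (simp add: real_sqrt_unique)
  qed
  have "((\<lambda>F. sqrt (?S - (\<Sum>i\<in>F. (cmod (x i))\<^sup>2))) \<longlongrightarrow> 0) (finite_subsets_at_top ?I)"
    using tendsto_real_sqrt[OF tendsto_diff[OF tendsto_const[of ?S]
          has_sum_infsum[OF ell2_summable[OF x], unfolded has_sum_def]]] by simp
  then have "((\<lambda>F. hnorm (ell2_krein A B) (sum ?g F - x)) \<longlongrightarrow> 0) (finite_subsets_at_top ?I)"
    by (rule Lim_transform_eventually) (rule eventually_mono[OF ev], simp add: norm_eq)
  moreover have "?g i \<in> ell2 ?I" if "i \<in> ?I" for i
    using that by (intro ell2_scale ell2_unit_in)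
  ultimately show ?thesis
    using x has_usum_iff[of ?I ?g x] by simp
qed

section \<open>Synthesis and analysis operators of a Bessel family\<close>

locale bessel = krein H for H :: "'a::ab_group_add krein" +
  fixes I :: "'i set" and f :: "'i \<Rightarrow> 'a" and \<beta> :: real
  assumes f_pts: "f ` I \<subseteq> pts H"
    and bound_pos: "0 < \<beta>"
    and bessel_summable: "x \<in> pts H \<Longrightarrow> (\<lambda>i. (cmod (hinner H x (f i)))\<^sup>2) summable_on I"
    and bessel_bound: "x \<in> pts H \<Longrightarrow>
      (\<Sum>\<^sub>\<infinity>i\<in>I. (cmod (hinner H x (f i)))\<^sup>2) \<le> \<beta> * (hnorm H x)\<^sup>2"
begin

lemma f_in [simp, intro]: "i \<in> I \<Longrightarrow> f i \<in> pts H"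
  using f_pts by blast

text \<open>
  For \<open>v = \<Sum> c i * f i\<close> the Cauchy-Schwarz inequality and the Bessel bound give
  \<open>\<parallel>v\<parallel>\<^sup>4 = \<bar>\<Sum> c i * \<langle>f i, v\<rangle>\<bar>\<^sup>2 \<le> (\<Sum> \<bar>c i\<bar>\<^sup>2) * \<beta> * \<parallel>v\<parallel>\<^sup>2\<close>.
\<close>

lemma finite_synthesis_bound:
  assumes F: "finite F" "F \<subseteq> I"
  shows "(hnorm H (\<Sum>i\<in>F. scl H (c i) (f i)))\<^sup>2 \<le> \<beta> * (\<Sum>i\<in>F. (cmod (c i))\<^sup>2)"
proof -
  define v where "v = (\<Sum>i\<in>F. scl H (c i) (f i))"
  have v: "v \<in> pts H" unfolding v_def using F by (intro V_sum V_scale f_in) auto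
  have hinner_sum: "hinner H (\<Sum>i\<in>F. scl H (c i) (f i)) v = (\<Sum>i\<in>F. c i * hinner H (f i) v)"
    using F
  proof (induction F rule: finite_induct)
    case empty
    then show ?case using v by simp
  next
    case (insert i F)
    have "(\<Sum>i\<in>F. scl H (c i) (f i)) \<in> pts H"
      using insert by (intro V_sum V_scale f_in) auto
    then show ?case using insert v by (simp add: q_add_left q_scale_left)
  qed
  have "(hnorm H v)\<^sup>2 = Re (\<Sum>i\<in>F. c i * hinner H (f i) v)"
    using hinner_sum nrm_sq[OF v] by (simp add: v_def)
  also have "\<dots> \<le> cmod (\<Sum>i\<in>F. c i * hinner H (f i) v)"
    by (rule complex_Re_le_cmod)
  also have "\<dots> \<le> (\<Sum>i\<in>F. cmod (c i * hinner H (f i) v))"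
    by (rule norm_sum)
  also have "\<dots> = (\<Sum>i\<in>F. cmod (c i) * cmod (hinner H v (f i)))"
  proof (rule sum.cong[OF refl])
    fix i assume "i \<in> F"
    then have "f i \<in> pts H" using F by blast
    then show "cmod (c i * hinner H (f i) v) = cmod (c i) * cmod (hinner H v (f i))"
      by (simp only: norm_mult q_commute[OF v] complex_mod_cnj)
  qed
  finally have "((hnorm H v)\<^sup>2)\<^sup>2 \<le> (\<Sum>i\<in>F. cmod (c i) * cmod (hinner H v (f i)))\<^sup>2"
    by (intro power_mono) simp_all
  also have "\<dots> \<le> (\<Sum>i\<in>F. (cmod (c i))\<^sup>2) * (\<Sum>i\<in>F. (cmod (hinner H v (f i)))\<^sup>2)"
    by (rule Cauchy_Schwarz_ineq_sum)
  also have "\<dots> \<le> (\<Sum>i\<in>F. (cmod (c i))\<^sup>2) * (\<beta> * (hnorm H v)\<^sup>2)"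
  proof (rule mult_left_mono)
    have "(\<Sum>i\<in>F. (cmod (hinner H v (f i)))\<^sup>2) \<le> (\<Sum>\<^sub>\<infinity>i\<in>I. (cmod (hinner H v (f i)))\<^sup>2)"
      by (rule finite_sum_le_infsum[OF bessel_summable[OF v] F]) simp
    then show "(\<Sum>i\<in>F. (cmod (hinner H v (f i)))\<^sup>2) \<le> \<beta> * (hnorm H v)\<^sup>2"
      using bessel_bound[OF v] by linarith
  qed (simp add: sum_nonneg)
  finally have le: "(hnorm H v)\<^sup>2 * (hnorm H v)\<^sup>2 \<le> (\<beta> * (\<Sum>i\<in>F. (cmod (c i))\<^sup>2)) * (hnorm H v)\<^sup>2"
    by (simp add: power2_eq_square mult_ac)
  show ?thesis
    unfolding v_def[symmetric]
  proof (cases "hnorm H v = 0")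
    case True
    then show "(hnorm H v)\<^sup>2 \<le> \<beta> * (\<Sum>i\<in>F. (cmod (c i))\<^sup>2)"
      using bound_pos by (simp add: sum_nonneg)
  next
    case False
    then show "(hnorm H v)\<^sup>2 \<le> \<beta> * (\<Sum>i\<in>F. (cmod (c i))\<^sup>2)"
      using mult_right_le_imp_le[OF le] by simp
  qed
qed

text \<open>
  By \<open>finite_synthesis_bound\<close>, partial sums differ by little once the remaining part of \<open>\<Sum> \<bar>x i\<bar>\<^sup>2\<close> is small.
\<close>

lemma synthesis_converges:
  assumes x: "x \<in> ell2 I"
  shows "\<exists>y. has_usum H (\<lambda>i. scl H (x i) (f i)) I y"
  unfolding has_usum_def htopology_def
proof (rule limitin_finite_subsets_of_Cauchy[OF complete])
  let ?g = "\<lambda>i. scl H (x i) (f i)" and ?w = "\<lambda>i. (cmod (x i))\<^sup>2"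
  show sum_in: "sum ?g F \<in> pts H" if "F \<subseteq> I" for F
    using that by (intro V_sum V_scale f_in) auto
  fix e :: real assume e: "e > 0"
  \<comment> \<open>This \<open>\<delta>\<close> turns the bound \<open>\<beta> * \<delta>\<close> on the squared distance into \<open>e\<^sup>2\<close>.\<close>
  define \<delta> where "\<delta> = e\<^sup>2 / \<beta>"
  have \<delta>: "\<delta> > 0" using e bound_pos by (simp add: \<delta>_def)
  obtain F0 where F0: "finite F0" "F0 \<subseteq> I" "dist (sum ?w F0) (infsum ?w I) \<le> \<delta> / 2"
    using has_sum_finite_approximation[OF has_sum_infsum[OF ell2_summable[OF x]], of "\<delta> / 2"] \<delta>
    by auto
  have "form_dist (pts H) (hinner H) (sum ?g F0) (sum ?g F) < e"
    if F: "finite F" "F0 \<subseteq> F" "F \<subseteq> I" for F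
  proof -
    have "sum ?w (F - F0) = sum ?w F - sum ?w F0" using F by (simp add: sum_diff)
    also have "sum ?w F \<le> infsum ?w I"
      by (rule finite_sum_le_infsum[OF ell2_summable[OF x] F(1,3)]) simp
    finally have tail: "sum ?w (F - F0) < \<delta>" 
      using F0(3) \<delta> abs_ge_minus_self[of "sum ?w F0 - infsum ?w I"]
      unfolding dist_real_def by linarith
    have "sum ?g F - sum ?g F0 = sum ?g (F - F0)" using F by (simp add: sum_diff)
    then have "(hnorm H (sum ?g F0 - sum ?g F))\<^sup>2 = (hnorm H (sum ?g (F - F0)))\<^sup>2"
      using nrm_minus_commute[OF sum_in[OF F0(2)] sum_in[OF F(3)]] by simp
    also have "\<dots> \<le> \<beta> * sum ?w (F - F0)" using F by (intro finite_synthesis_bound) auto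
    also have "\<dots> < \<beta> * \<delta>" using tail bound_pos by simp
    also have "\<dots> = e\<^sup>2" using bound_pos by (simp add: \<delta>_def)
    finally show ?thesis
      using e F F0 sum_in by (simp add: form_dist_eq power2_less_imp_less)
  qed
  then show "\<exists>F0. finite F0 \<and> F0 \<subseteq> I \<and> (\<forall>F. finite F \<and> F0 \<subseteq> F \<and> F \<subseteq> I \<longrightarrow>
      form_dist (pts H) (hinner H) (sum ?g F0) (sum ?g F) < e)"
    using F0 by blast
qed

abbreviation T :: "('i \<Rightarrow> complex) \<Rightarrow> 'a" where "T \<equiv> synthesis H I f"

lemma has_usum_synthesis:
  assumes "x \<in> ell2 I"
  shows "has_usum H (\<lambda>i. scl H (x i) (f i)) I (T x)"
proof -
  obtain y where y: "has_usum H (\<lambda>i. scl H (x i) (f i)) I y"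
    using synthesis_converges[OF assms] ..
  have "T x = y"
    unfolding synthesis_def
    using y limitin_metric_unique[OF _ _ finite_subsets_at_top_neq_bot]
    unfolding has_usum_def htopology_def by blast
  with y show ?thesis by simp
qed

lemma synthesis_in [simp, intro]: "x \<in> ell2 I \<Longrightarrow> T x \<in> pts H"
  using has_usum_synthesis[of x] limitin_mspace unfolding has_usum_def htopology_def by blast

lemma form_synthesis:
  assumes x: "x \<in> ell2 I" and z: "z \<in> pts H"
  shows "((\<lambda>i. x i * form H (f i) z) has_sum form H (T x) z) I"
proof -
  have "((\<lambda>i. form H (scl H (x i) (f i)) z) has_sum form H (T x) z) I"
    by (rule has_usum_form[OF has_usum_synthesis[OF x] _ z]) auto
  then show ?thesis
    by (rule has_sum_cong[THEN iffD1, rotated]) (simp add: form_scale_left z)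
qed

text \<open>
  The synthesis operator is determined weakly. Its linearity and, later, the identity
  \<open>T T\<^sup>+ = 1\<close> are proved in this way, without any further argument about convergence in norm.
\<close>

lemma synthesis_eqI:
  assumes "x \<in> ell2 I" "y \<in> pts H"
    and "\<And>z. z \<in> pts H \<Longrightarrow> ((\<lambda>i. x i * form H (f i) z) has_sum form H y z) I"
  shows "T x = y"
proof (rule form_ext)
  fix z assume "z \<in> pts H"
  then show "form H (T x) z = form H y z"
    using has_sum_unique[OF form_synthesis assms(3)] assms(1) by blast
qed (use assms in auto)

lemma synthesis_add:
  assumes "x \<in> ell2 I" "y \<in> ell2 I"
  shows "T (x + y) = T x + T y"
proof (rule synthesis_eqI)
  fix z assume "z \<in> pts H"
  then show "((\<lambda>i. (x + y) i * form H (f i) z) has_sum form H (T x + T y) z) I"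
    using has_sum_add[OF form_synthesis[OF assms(1)] form_synthesis[OF assms(2)]] assms
    by (simp add: form_add_left distrib_right)
qed (use assms in \<open>simp_all add: ell2_add\<close>)

lemma synthesis_scale:
  assumes "x \<in> ell2 I"
  shows "T (cscale c x) = scl H c (T x)"
proof (rule synthesis_eqI)
  fix z assume "z \<in> pts H"
  then show "((\<lambda>i. cscale c x i * form H (f i) z) has_sum form H (scl H c (T x)) z) I"
    using has_sum_cmult_right[OF form_synthesis[OF assms], of z c] assms
    by (simp add: form_scale_left mult.assoc)
qed (use assms in \<open>simp_all add: ell2_scale\<close>)

lemma synthesis_unit: "i \<in> I \<Longrightarrow> T (ell2_unit i) = f i"
proof (rule synthesis_eqI)
  fix z assume i: "i \<in> I"
  have "((\<lambda>j. ell2_unit i j * form H (f j) z) has_sum form H (f i) z) {i}"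
    by (rule has_sum_finiteI) (simp_all add: ell2_unit_def)
  then show "((\<lambda>j. ell2_unit i j * form H (f j) z) has_sum form H (f i) z) I"
    by (rule has_sum_cong_neutral[THEN iffD1, rotated -1]) (use i in \<open>auto simp: ell2_unit_def\<close>)
qed (auto simp: ell2_unit_in)

lemma hnorm_synthesis_le:
  assumes x: "x \<in> ell2 I"
  shows "(hnorm H (T x))\<^sup>2 \<le> \<beta> * (\<Sum>\<^sub>\<infinity>i\<in>I. (cmod (x i))\<^sup>2)"
proof -
  let ?g = "\<lambda>i. scl H (x i) (f i)" and ?S = "\<Sum>\<^sub>\<infinity>i\<in>I. (cmod (x i))\<^sup>2"
  have ev: "\<forall>\<^sub>F F in finite_subsets_at_top I. finite F \<and> F \<subseteq> I"
    by (simp add: eventually_finite_subsets_at_top_weakI)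
  have sum_in: "sum ?g F \<in> pts H" if "F \<subseteq> I" for F
    using that by (intro V_sum V_scale f_in) auto
  have S: "0 \<le> \<beta> * ?S" using bound_pos by (simp add: infsum_nonneg)
  have "((\<lambda>F. hnorm H (sum ?g F - T x)) \<longlongrightarrow> 0) (finite_subsets_at_top I)"
    using has_usum_synthesis[OF x] has_usum_iff[of I ?g "T x"] by simp
  then have lim: "((\<lambda>F. hnorm H (sum ?g F - T x) + sqrt (\<beta> * ?S)) \<longlongrightarrow> 0 + sqrt (\<beta> * ?S))
      (finite_subsets_at_top I)"
    by (intro tendsto_intros)
  have "hnorm H (T x) \<le> hnorm H (sum ?g F - T x) + sqrt (\<beta> * ?S)" if F: "finite F" "F \<subseteq> I" for F
  proof -
    have "(hnorm H (sum ?g F))\<^sup>2 \<le> \<beta> * (\<Sum>i\<in>F. (cmod (x i))\<^sup>2)"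
      using F by (rule finite_synthesis_bound)
    also have "\<dots> \<le> \<beta> * ?S"
      using bound_pos by (intro mult_left_mono finite_sum_le_infsum ell2_summable x F) auto
    finally have "hnorm H (sum ?g F) \<le> sqrt (\<beta> * ?S)" by (rule real_le_rsqrt)
    moreover have "hnorm H (T x) \<le> hnorm H (T x - sum ?g F) + hnorm H (sum ?g F)"
      using nrm_triangle[of "T x - sum ?g F" "sum ?g F"] sum_in[OF F(2)] x by simp
    ultimately show ?thesis
      using nrm_minus_commute[of "T x" "sum ?g F"] sum_in[OF F(2)] x by simp
  qed
  then have "\<forall>\<^sub>F F in finite_subsets_at_top I.
      hnorm H (T x) \<le> hnorm H (sum ?g F - T x) + sqrt (\<beta> * ?S)"
    by (intro eventually_mono[OF ev]) blast
  then have "hnorm H (T x) \<le> sqrt (\<beta> * ?S)"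
    using tendsto_lowerbound[OF lim _ finite_subsets_at_top_neq_bot] by simp
  then show ?thesis
    using S power_mono[of "hnorm H (T x)" "sqrt (\<beta> * ?S)" 2] x by simp
qed

abbreviation I\<^sub>p where "I\<^sub>p \<equiv> idx_pos H I f"
abbreviation I\<^sub>n where "I\<^sub>n \<equiv> idx_neg H I f"

lemma idx_Un: "I\<^sub>p \<union> I\<^sub>n = I" and idx_Int: "I\<^sub>p \<inter> I\<^sub>n = {}" "I\<^sub>n \<inter> I\<^sub>p = {}"
  by (auto simp: idx_pos_def idx_neg_def)

lemma idx_subset: "I\<^sub>p \<subseteq> I" "I\<^sub>n \<subseteq> I"
  by (auto simp: idx_pos_def idx_neg_def)

text \<open>
  The adjoint \<open>T\<^sup>+\<close> of the synthesis operator for the indefinite forms: as the form of \<open>ell2\<close> is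
  negative on \<open>I\<^sub>n\<close>, so are the signs of the coefficients there.
\<close>

definition analysis :: "'a \<Rightarrow> 'i \<Rightarrow> complex" where
  "analysis y = (\<lambda>i. if i \<in> I\<^sub>p then form H y (f i) else if i \<in> I\<^sub>n then - form H y (f i) else 0)"

lemma cmod_analysis: "i \<in> I \<Longrightarrow> cmod (analysis y i) = cmod (form H y (f i))"
  using idx_Un by (auto simp: analysis_def)

lemma analysis_sq:
  assumes y: "y \<in> pts H"
  shows "(\<lambda>i. (cmod (analysis y i))\<^sup>2) summable_on I"
    and "(\<Sum>\<^sub>\<infinity>i\<in>I. (cmod (analysis y i))\<^sup>2) = (\<Sum>\<^sub>\<infinity>i\<in>I. (cmod (hinner H (J y) (f i)))\<^sup>2)"
proof -
  have eq: "(cmod (analysis y i))\<^sup>2 = (cmod (hinner H (J y) (f i)))\<^sup>2" if "i \<in> I" for i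
    using that y by (simp add: cmod_analysis form_eq_hinner)
  show "(\<Sum>\<^sub>\<infinity>i\<in>I. (cmod (analysis y i))\<^sup>2) = (\<Sum>\<^sub>\<infinity>i\<in>I. (cmod (hinner H (J y) (f i)))\<^sup>2)"
    by (rule infsum_cong) (rule eq)
  show "(\<lambda>i. (cmod (analysis y i))\<^sup>2) summable_on I"
    using bessel_summable[OF J_in[OF y]] summable_on_cong[of I, OF eq] by simp
qed

lemma analysis_in [simp, intro]: "y \<in> pts H \<Longrightarrow> analysis y \<in> ell2 I"
  using analysis_sq(1)[of y] idx_subset by (auto simp: ell2_def analysis_def)

lemma analysis_bound: "y \<in> pts H \<Longrightarrow>
    (\<Sum>\<^sub>\<infinity>i\<in>I. (cmod (analysis y i))\<^sup>2) \<le> \<beta> * (hnorm H y)\<^sup>2"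
  using bessel_bound[of "J y"] by (simp add: analysis_sq(2) hnorm_J)

lemma analysis_add: "x \<in> pts H \<Longrightarrow> y \<in> pts H \<Longrightarrow> analysis (x + y) = analysis x + analysis y"
  using idx_subset by (auto simp: analysis_def fun_eq_iff form_add_left subset_eq)

lemma analysis_scale: "x \<in> pts H \<Longrightarrow> analysis (scl H c x) = cscale c (analysis x)"
  using idx_subset by (auto simp: analysis_def fun_eq_iff form_scale_left subset_eq)

lemma analysis_zero: "analysis 0 = 0"
  using idx_subset by (auto simp: analysis_def fun_eq_iff)

text \<open>
  The sum over \<open>I\<^sub>n\<close> changes sign twice, once in the form of \<open>ell2\<close> and once in the definition of
  \<open>analysis\<close>.
\<close>

lemma analysis_adjoint:
  assumes x: "x \<in> ell2 I" and y: "y \<in> pts H"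
  shows "form H (T x) y = ell2_form I\<^sub>p I\<^sub>n x (analysis y)"
proof -
  let ?t = "\<lambda>i. x i * form H (f i) y"
  have sum: "?t summable_on I" "form H (T x) y = infsum ?t I"
    using form_synthesis[OF x y] by (auto simp: has_sum_iff)
  have sub: "?t summable_on I\<^sub>p" "?t summable_on I\<^sub>n"
    using summable_on_subset_banach[OF sum(1)] idx_subset by auto
  have "infsum ?t (I\<^sub>p \<union> I\<^sub>n) = infsum ?t I\<^sub>p + infsum ?t I\<^sub>n"
    by (rule infsum_Un_disjoint[OF sub idx_Int(1)])
  also have "infsum ?t I\<^sub>p = (\<Sum>\<^sub>\<infinity>i\<in>I\<^sub>p. x i * cnj (analysis y i))"
  proof (rule infsum_cong)
    fix i assume "i \<in> I\<^sub>p"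
    then show "?t i = x i * cnj (analysis y i)"
      using form_commute[OF y, of "f i"] idx_subset by (auto simp: analysis_def)
  qed
  also have "infsum ?t I\<^sub>n = - (\<Sum>\<^sub>\<infinity>i\<in>I\<^sub>n. x i * cnj (analysis y i))"
    unfolding infsum_uminus[symmetric]
  proof (rule infsum_cong)
    fix i assume "i \<in> I\<^sub>n"
    then show "?t i = - (x i * cnj (analysis y i))"
      using form_commute[OF y, of "f i"] idx_subset idx_Int by (auto simp: analysis_def)
  qed
  finally show ?thesis using sum(2) by (simp add: idx_Un ell2_form_def)
qed

lemma krein_adjoint_analysis:
  "krein_adjoint (ell2 I) (ell2_form I\<^sub>p I\<^sub>n) (pts H) (form H) T analysis"
  by (auto simp: krein_adjoint_def analysis_adjoint)

text \<open>
  Inserting the unit vectors recovers the coordinates of \<open>T' y\<close>.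
\<close>

lemma krein_adjoint_unique:
  assumes "krein_adjoint (ell2 I) (ell2_form I\<^sub>p I\<^sub>n) (pts H) (form H) T T'" and y: "y \<in> pts H"
  shows "T' y = analysis y"
proof
  fix i
  have T': "T' y \<in> ell2 I" and adj: "form H (T x) y = ell2_form I\<^sub>p I\<^sub>n x (T' y)" if "x \<in> ell2 I" for x
    using assms that by (auto simp: krein_adjoint_def)
  show "T' y i = analysis y i"
  proof (cases "i \<in> I")
    case True
    let ?e = "ell2_unit i :: 'i \<Rightarrow> complex"
    have unit: "ell2_inner A ?e z = (if i \<in> A then cnj (z i) else 0)" if "A \<subseteq> I" for A z
    proof -
      have "ell2_inner A ?e z = cnj (ell2_inner A z ?e)"
        unfolding ell2_inner_def by (simp add: mult.commute flip: infsum_cnj)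
      then show ?thesis by (simp add: ell2_inner_unit)
    qed
    have "ell2_form I\<^sub>p I\<^sub>n ?e (T' y) = ell2_form I\<^sub>p I\<^sub>n ?e (analysis y)"
      using adj[of ?e] analysis_adjoint[of ?e y] True y by (simp add: ell2_unit_in)
    then show ?thesis
      using True idx_Un idx_Int idx_subset by (auto simp: ell2_form_eq unit split: if_splits)
  next
    case False
    then show ?thesis
      using ell2_outside[OF T'[OF ell2_zero]] ell2_outside[OF analysis_in[OF y]] by simp
  qed
qed

lemma range_synthesis_restrict:
  assumes A: "A \<subseteq> I"
  shows "(\<lambda>x. T (ell2_restrict A x)) ` ell2 I = T ` ell2 A"
proof
  show "(\<lambda>x. T (ell2_restrict A x)) ` ell2 I \<subseteq> T ` ell2 A"
    using ell2_restrict_in[OF _ A] by blast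
  show "T ` ell2 A \<subseteq> (\<lambda>x. T (ell2_restrict A x)) ` ell2 I"
  proof
    fix y assume "y \<in> T ` ell2 A"
    then obtain x where x: "x \<in> ell2 A" "y = T x" by blast
    then have "y = T (ell2_restrict A x)" by (simp add: ell2_restrict_id)
    then show "y \<in> (\<lambda>x. T (ell2_restrict A x)) ` ell2 I" using ell2_mono[OF x(1) A] by blast
  qed
qed

lemma subspace_of_range_synthesis:
  assumes A: "A \<subseteq> I"
  shows "subspace_of H (T ` ell2 A)"
  unfolding subspace_of_def subspace_def
proof (intro conjI ballI allI)
  have sub: "x \<in> ell2 I" if "x \<in> ell2 A" for x using ell2_mono[OF that A] .
  show "T ` ell2 A \<subseteq> pts H" using sub by blast
  have "T 0 = 0"
    using synthesis_scale[OF ell2_zero, of 0] by (simp add: cscale_def zero_fun_def)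
  then show "0 \<in> T ` ell2 A" using ell2_zero by (metis imageI)
  fix x assume "x \<in> T ` ell2 A"
  then obtain u where u: "u \<in> ell2 A" "x = T u" by blast
  show "scl H c x \<in> T ` ell2 A" for c
    using u synthesis_scale[OF sub[OF u(1)], of c] ell2_scale[OF u(1), of c] by (metis imageI)
  fix y assume "y \<in> T ` ell2 A"
  then obtain v where v: "v \<in> ell2 A" "y = T v" by blast
  show "x + y \<in> T ` ell2 A"
    using u v synthesis_add[OF sub[OF u(1)] sub[OF v(1)]] ell2_add[OF u(1) v(1)] by (metis imageI)
qed

lemma f_in_range: "i \<in> A \<Longrightarrow> A \<subseteq> I \<Longrightarrow> f i \<in> T ` ell2 A"
  using synthesis_unit[of i] ell2_unit_in[of i A] by (metis imageI subsetD)

lemma J_frame_iff: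
  "J_frame H I f \<longleftrightarrow> maximal_unif_pos H (T ` ell2 I\<^sub>p) \<and> maximal_unif_neg H (T ` ell2 I\<^sub>n)"
proof -
  have "bessel_family H I f"
    using f_pts bound_pos bessel_summable bessel_bound unfolding bessel_family_def by blast
  then show ?thesis by (simp add: J_frame_def range_synthesis_restrict idx_subset)
qed

text \<open>
  Since the adjoint is unique, the existential quantifier over it can be dropped.
\<close>

lemma parseval_J_frame_iff:
  "parseval_J_frame H I f \<longleftrightarrow> J_frame H I f \<and> (\<forall>y\<in>pts H. T (analysis y) = y)"
  using krein_adjoint_analysis krein_adjoint_unique unfolding parseval_J_frame_def
  by (metis (no_types, lifting))

lemma synthesis_split:
  assumes x: "x \<in> ell2 I"
  shows "T x = T (ell2_restrict I\<^sub>p x) + T (ell2_restrict I\<^sub>n x)"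
proof -
  have "x = ell2_restrict I\<^sub>p x + ell2_restrict I\<^sub>n x"
    using ell2_restrict_add[of x "I\<^sub>p" "I\<^sub>n"] x idx_Un idx_Int by simp
  then show ?thesis
    using synthesis_add[OF ell2_mono[OF ell2_restrict_in[OF x idx_subset(1)] idx_subset(1)]
        ell2_mono[OF ell2_restrict_in[OF x idx_subset(2)] idx_subset(2)]] by simp
qed

section \<open>Parseval J-frames dilate to orthonormal bases\<close>

text \<open>
  Let \<open>w\<close> be the part of \<open>T\<^sup>+ x\<close> on \<open>B\<close>. Then \<open>0 = [T w, x] = [w, T\<^sup>+ x]\<^sub>2 = \<plusminus> \<parallel>w\<parallel>\<^sup>2\<close>.
\<close>

lemma analysis_support:
  assumes AB: "A = I\<^sub>p \<and> B = I\<^sub>n \<or> A = I\<^sub>n \<and> B = I\<^sub>p" and x: "x \<in> pts H"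
    and 0: "T (ell2_restrict B (analysis x)) = 0"
  shows "analysis x \<in> ell2 A"
proof -
  let ?a = "analysis x"
  let ?w = "ell2_restrict B ?a"
  have sets: "A \<subseteq> I" "B \<subseteq> I" "A \<inter> B = {}" "A \<union> B = I"
    using AB idx_subset idx_Int idx_Un by auto
  have w: "?w \<in> ell2 B" using ell2_restrict_in[OF _ sets(2)] x by simp
  have "ell2_inner B ?w ?a = ell2_inner B ?w ?w"
    unfolding ell2_inner_def by (rule infsum_cong) (simp add: ell2_restrict_def)
  moreover have "ell2_inner A ?w ?a = 0"
    by (rule ell2_inner_outside(1)[OF sets(3) w])
  moreover have "ell2_form I\<^sub>p I\<^sub>n ?w ?a = 0"
    using analysis_adjoint[OF ell2_mono[OF w sets(2)] x] 0 x by simp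
  ultimately have "ell2_inner B ?w ?w = 0"
    using AB by (auto simp: ell2_form_eq)
  then have "?w = 0" using ell2.pos_def[OF w] by force
  then have "?a = ell2_restrict A ?a"
    using ell2_restrict_add[of ?a A B] x sets by simp
  then show ?thesis using ell2_restrict_in[OF analysis_in[OF x] sets(1)] by simp
qed

text \<open>
  In a Parseval J-frame the two ranges are orthogonal to each other. The part of \<open>x = T T\<^sup>+ x\<close>
  that comes from the opposite index set lies in both ranges, one of which is positive and the
  other negative.
\<close>

lemma parseval_analysis_supported:
  assumes P: "parseval_J_frame H I f"
  shows "x \<in> T ` ell2 I\<^sub>p \<Longrightarrow> analysis x \<in> ell2 I\<^sub>p"
    and "x \<in> T ` ell2 I\<^sub>n \<Longrightarrow> analysis x \<in> ell2 I\<^sub>n"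
proof -
  let ?p = "ell2_restrict I\<^sub>p (analysis x)" and ?n = "ell2_restrict I\<^sub>n (analysis x)"
  have pos: "unif_pos H (T ` ell2 I\<^sub>p)" and neg: "unif_neg H (T ` ell2 I\<^sub>n)"
    and id: "y \<in> pts H \<Longrightarrow> T (analysis y) = y" for y
    using P by (auto simp: parseval_J_frame_iff J_frame_iff maximal_unif_pos_def maximal_unif_neg_def)
  note sub = subspace_of_range_synthesis[OF idx_subset(1), unfolded subspace_of_def]
    subspace_of_range_synthesis[OF idx_subset(2), unfolded subspace_of_def]
  have split: "x = T ?p + T ?n" and p: "T ?p \<in> T ` ell2 I\<^sub>p" and n: "T ?n \<in> T ` ell2 I\<^sub>n"
    if x: "x \<in> pts H"
    using synthesis_split[OF analysis_in[OF x]] id[OF x]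
      ell2_restrict_in[OF analysis_in[OF x] idx_subset(1)]
      ell2_restrict_in[OF analysis_in[OF x] idx_subset(2)] by auto
  show "analysis x \<in> ell2 I\<^sub>p" if x: "x \<in> T ` ell2 I\<^sub>p"
  proof -
    have x_pts: "x \<in> pts H" using x sub by blast
    have "x - T ?p \<in> T ` ell2 I\<^sub>p" using sub x p[OF x_pts] by (intro subspace_diff) auto
    moreover have "x - T ?p = T ?n" using split[OF x_pts] by (metis add_diff_cancel_left')
    ultimately have "T ?n = 0" using unif_pos_neg_Int[OF pos neg _ n[OF x_pts]] by simp
    then show ?thesis using analysis_support[of "I\<^sub>p" "I\<^sub>n"] x_pts by blast
  qed
  show "analysis x \<in> ell2 I\<^sub>n" if x: "x \<in> T ` ell2 I\<^sub>n"
  proof -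
    have x_pts: "x \<in> pts H" using x sub by blast
    have "x - T ?n \<in> T ` ell2 I\<^sub>n" using sub x n[OF x_pts] by (intro subspace_diff) auto
    moreover have "x - T ?n = T ?p" using split[OF x_pts] by (metis add_diff_cancel_right')
    ultimately have "T ?p = 0" using unif_pos_neg_Int[OF pos neg p[OF x_pts]] by simp
    then show ?thesis using analysis_support[of "I\<^sub>n" "I\<^sub>p"] x_pts by blast
  qed
qed

text \<open>
  The dilation is \<open>ell2 I\<close> itself, with \<open>H\<close> embedded by \<open>T\<^sup>+\<close>. Idempotence of \<open>E = T\<^sup>+ T\<close> and the isometry
  of \<open>T\<^sup>+\<close> are both consequences of \<open>T T\<^sup>+ = 1\<close>, and regularity of the range holds because
  \<open>x - E x\<close> is orthogonal to it.
\<close>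

lemma parseval_imp_dilation:
  assumes P: "parseval_J_frame H I f"
  shows "regular_dilation H I f (ell2_krein I\<^sub>p I\<^sub>n) analysis ell2_unit
    (\<lambda>i. if i \<in> I\<^sub>p then 1 else - 1) (\<lambda>x. analysis (T x))"
proof -
  let ?K = "ell2_krein I\<^sub>p I\<^sub>n" and ?\<epsilon> = "\<lambda>i. if i \<in> I\<^sub>p then 1 else - 1 :: complex"
  let ?S = "analysis ` pts H" and ?E = "\<lambda>x. analysis (T x)"
  have krein_K: "krein_space ?K" by (rule krein_space_ell2[OF idx_Int(1)])
  interpret K: krein ?K by unfold_locales (rule krein_K)
  note simps = ell2_krein_simps idx_Un
  have id: "T (analysis y) = y" if "y \<in> pts H" for y
    using P that by (simp add: parseval_J_frame_iff)
  have linear_\<iota>: "linear_between H ?K analysis"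
    by (auto simp: linear_between_def simps analysis_add analysis_scale)
  have isometric: "ell2_form I\<^sub>p I\<^sub>n (analysis x) (analysis y) = form H x y"
    if "x \<in> pts H" "y \<in> pts H" for x y
    using analysis_adjoint[OF analysis_in[OF that(1)] that(2)] id[OF that(1)] by simp
  have contains: "contains_via ?K H analysis"
    unfolding contains_via_def using linear_\<iota> isometric
    by (intro conjI inj_on_inverseI[of _ T]) (simp_all add: id)
  have adj: "ell2_form I\<^sub>p I\<^sub>n (analysis y) x = form H y (T x)" if "x \<in> ell2 I" "y \<in> pts H" for x y
  proof -
    have "ell2_form I\<^sub>p I\<^sub>n (analysis y) x = cnj (ell2_form I\<^sub>p I\<^sub>n x (analysis y))"
      using K.form_commute[of x "analysis y"] that by (simp add: simps)
    also have "\<dots> = cnj (form H (T x) y)" by (simp only: analysis_adjoint[OF that])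
    also have "\<dots> = form H y (T x)"
      by (rule form_commute[symmetric]) (use that in auto)
    finally show ?thesis .
  qed
  have subspace_S: "subspace_of ?K ?S"
    unfolding subspace_of_def K.subspace_def
  proof (intro conjI ballI allI)
    show "0 \<in> ?S" using analysis_zero by (metis V_zero imageI)
    show "?S \<subseteq> pts ?K" by (auto simp: simps)
    fix u assume "u \<in> ?S"
    then obtain x where x: "x \<in> pts H" "u = analysis x" by blast
    show "scl ?K c u \<in> ?S" for c
      using analysis_scale[OF x(1), of c] x by (metis V_scale imageI ell2_krein_simps(1))
    fix v assume "v \<in> ?S"
    then obtain y where y: "y \<in> pts H" "v = analysis y" by blast
    show "u + v \<in> ?S" using analysis_add[OF x(1) y(1)] x y by (metis V_add imageI)
  qed
  have complement: "x - ?E x \<in> form_compl ?K ?S" if x: "x \<in> ell2 I" for x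
  proof -
    have "ell2_form I\<^sub>p I\<^sub>n (x - ?E x) (analysis y) = 0" if y: "y \<in> pts H" for y
      using K.form_diff_left[of x "?E x" "analysis y"] analysis_adjoint[OF x y]
        isometric[of "T x" y] x y by (simp add: simps)
    moreover have "x - ?E x \<in> ell2 I" using x by (intro ell2.V_diff) auto
    ultimately show ?thesis by (auto simp: form_compl_def simps)
  qed
  have direct: "direct_sum (pts ?K) ?S (form_compl ?K ?S)"
    unfolding direct_sum_def
  proof (intro conjI set_eqI iffI)
    fix x assume "x \<in> pts ?K"
    then have x: "x \<in> ell2 I" by (simp add: simps)
    have "x = ?E x + (x - ?E x)" by simp
    then show "x \<in> {a + b |a b. a \<in> ?S \<and> b \<in> form_compl ?K ?S}"
      using complement[OF x] x by blast
  next
    fix x assume "x \<in> {a + b |a b. a \<in> ?S \<and> b \<in> form_compl ?K ?S}"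
    then show "x \<in> pts ?K" using subspace_S by (auto simp: form_compl_def subspace_of_def)
  next
    fix x assume x: "x \<in> ?S \<inter> form_compl ?K ?S"
    then obtain y where y: "y \<in> pts H" "x = analysis y" by blast
    have "form H y z = 0" if "z \<in> pts H" for z
      using x y that isometric[OF y(1) that] by (auto simp: form_compl_def simps)
    then have "y = 0" by (rule form_nondegenerate[OF y(1)])
    then have "x = 0" using y analysis_zero by simp
    then show "x \<in> {0}" by simp
  next
    fix x :: "'i \<Rightarrow> complex" assume "x \<in> {0}"
    then have x: "x = 0" by simp
    have "0 \<in> ?S" "?S \<subseteq> pts ?K"
      using subspace_S K.subspace_0 unfolding subspace_of_def by blast+
    then have "form ?K 0 u = 0" if "u \<in> ?S" for u
      using that by (intro K.form_zero) blast
    then show "x \<in> ?S \<inter> form_compl ?K ?S"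
      unfolding x form_compl_def using \<open>0 \<in> ?S\<close> K.V_zero by blast
  qed
  have regular: "regular_subspace ?K ?S" by (rule K.regular_subspaceI[OF subspace_S direct])
  \<comment> \<open>Outside \<open>I\<close> both sides are 0, so the equation needs no restriction on \<open>i\<close>.\<close>
  have coeff: "?\<epsilon> i * ell2_form I\<^sub>p I\<^sub>n x (ell2_unit i) = x i" if "x \<in> ell2 I" for x i
    using ell2_outside[OF that, of i] idx_Un idx_Int
    by (auto simp: ell2_form_eq ell2_inner_unit)
  have onb: "orthonormal_basis ?K I ell2_unit ?\<epsilon>"
    unfolding orthonormal_basis_def
  proof (intro conjI ballI)
    show "ell2_unit ` I \<subseteq> pts ?K" by (auto simp: simps ell2_unit_in)
    show "?\<epsilon> ` I \<subseteq> {1, - 1}" by auto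
    show "form ?K (ell2_unit i) (ell2_unit j) = (if i = j then ?\<epsilon> i else 0)"
      if "i \<in> I" "j \<in> I" for i j
      using that idx_Un idx_Int by (auto simp: ell2_form_eq ell2_inner_unit) (auto simp: ell2_unit_def)
    fix x assume "x \<in> pts ?K"
    then have x: "x \<in> ell2 I" by (simp add: simps)
    show "has_usum ?K (\<lambda>i. scl ?K (?\<epsilon> i * form ?K x (ell2_unit i)) (ell2_unit i)) I x"
      using ell2_unit_expansion[OF idx_Int(1), of x] x by (simp only: simps coeff[OF x])
  qed
  have "linear_between ?K ?K ?E"
    by (auto simp: linear_between_def simps analysis_add analysis_scale synthesis_add synthesis_scale)
  moreover have "hnorm ?K (?E x) \<le> \<beta> * hnorm ?K x" if "x \<in> pts ?K" for x
  proof (rule power2_le_imp_le)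
    have x: "x \<in> ell2 I" using that by (simp add: simps)
    have "(hnorm ?K (?E x))\<^sup>2 = (\<Sum>\<^sub>\<infinity>i\<in>I. (cmod (?E x i))\<^sup>2)"
      using hnorm_ell2_sq[OF idx_Int(1), of "?E x"] x by (simp add: idx_Un)
    also have "\<dots> \<le> \<beta> * (hnorm H (T x))\<^sup>2" using x by (intro analysis_bound) auto
    also have "\<dots> \<le> \<beta> * (\<beta> * (\<Sum>\<^sub>\<infinity>i\<in>I. (cmod (x i))\<^sup>2))"
      using hnorm_synthesis_le[OF x] bound_pos by simp
    also have "\<dots> = (\<beta> * hnorm ?K x)\<^sup>2"
      using hnorm_ell2_sq[OF idx_Int(1), of x] x
      by (simp add: idx_Un power_mult_distrib power2_eq_square[of \<beta>] mult.assoc)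
    finally show "(hnorm ?K (?E x))\<^sup>2 \<le> (\<beta> * hnorm ?K x)\<^sup>2" .
    show "0 \<le> \<beta> * hnorm ?K x" using bound_pos K.nrm_nonneg[OF that] by simp
  qed
  ultimately have bounded: "bounded_operator ?K ?E" unfolding bounded_operator_def by blast
  have "?E ` pts ?K = ?S"
  proof
    show "?E ` pts ?K \<subseteq> ?S" by (auto simp: simps)
    show "?S \<subseteq> ?E ` pts ?K"
    proof
      fix u assume "u \<in> ?S"
      then obtain y where y: "y \<in> pts H" "u = analysis y" by blast
      then have "u = ?E u" by (simp add: id)
      moreover have "u \<in> pts ?K" using y by (simp add: simps)
      ultimately show "u \<in> ?E ` pts ?K" by blast
    qed
  qed
  moreover have "krein_adjoint (pts ?K) (form ?K) (pts ?K) (form ?K) ?E ?E"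
    by (auto simp: krein_adjoint_def simps adj analysis_adjoint[symmetric])
  ultimately have proj: "selfadjoint_projection_onto ?K ?S ?E"
    using bounded by (simp add: selfadjoint_projection_onto_def simps id)
  have "analysis ` f ` I\<^sub>p \<subseteq> pos ?K" "analysis ` f ` I\<^sub>n \<subseteq> neg ?K"
    using parseval_analysis_supported[OF P] f_in_range[OF _ idx_subset(1)]
      f_in_range[OF _ idx_subset(2)] by auto
  then show ?thesis
    unfolding regular_dilation_def
    using krein_K contains regular onb proj by (simp add: synthesis_unit)
qed

section \<open>Projections of orthonormal bases are Parseval J-frames\<close>

text \<open>
  Orthogonality of two sets of frame vectors passes to the ranges of the synthesis operator, one
  argument of the form at a time.
\<close>

lemma synthesis_orthogonal:
  assumes AB: "A \<subseteq> I" "B \<subseteq> I" and orth: "\<And>i j. i \<in> A \<Longrightarrow> j \<in> B \<Longrightarrow> form H (f i) (f j) = 0"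
    and u: "u \<in> ell2 A" and v: "v \<in> ell2 B"
  shows "form H (T u) (T v) = 0"
proof -
  have uI: "u \<in> ell2 I" and vI: "v \<in> ell2 I" using ell2_mono[OF u AB(1)] ell2_mono[OF v AB(2)] .
  have "form H (f i) (T v) = 0" if i: "i \<in> A" for i
  proof -
    have fi: "f i \<in> pts H" using i AB by blast
    have "((\<lambda>j. v j * form H (f j) (f i)) has_sum 0) I"
    proof (rule has_sum_0)
      fix j assume j: "j \<in> I"
      show "v j * form H (f j) (f i) = 0"
      proof (cases "j \<in> B")
        case True
        then show ?thesis using orth[OF i True] form_commute[OF fi f_in[OF j]] by simp
      qed (simp add: ell2_outside[OF v])
    qed
    then have "form H (T v) (f i) = 0" using has_sum_unique[OF form_synthesis[OF vI fi]] by blast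
    then show ?thesis using form_commute[OF synthesis_in[OF vI] fi] by simp
  qed
  then have "((\<lambda>i. u i * form H (f i) (T v)) has_sum 0) I"
    using ell2_outside[OF u] by (intro has_sum_0) (metis mult_eq_0_iff)
  then show ?thesis using has_sum_unique[OF form_synthesis[OF uI synthesis_in[OF vI]]] by blast
qed

text \<open>
  By \<open>T T\<^sup>+ = 1\<close>, \<open>[x, x] = [T\<^sup>+ x, T\<^sup>+ x]\<^sub>2\<close>. When \<open>T\<^sup>+ x\<close> is supported in one of the two index sets, this
  is plus or minus the full sum of \<open>\<bar>[x, f i]\<bar>\<^sup>2 = \<bar>\<langle>J x, f i\<rangle>\<bar>\<^sup>2\<close>, and the lower frame bound for \<open>J x\<close> applies.
\<close>

lemma uniform_bounds:
  assumes lower: "\<And>x. x \<in> pts H \<Longrightarrow>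
      \<alpha> * (hnorm H x)\<^sup>2 \<le> (\<Sum>\<^sub>\<infinity>i\<in>I. (cmod (hinner H x (f i)))\<^sup>2)"
    and id: "\<And>y. y \<in> pts H \<Longrightarrow> T (analysis y) = y" and x: "x \<in> pts H"
  shows "analysis x \<in> ell2 I\<^sub>p \<Longrightarrow> \<alpha> * (hnorm H x)\<^sup>2 \<le> Re (form H x x)"
    and "analysis x \<in> ell2 I\<^sub>n \<Longrightarrow> \<alpha> * (hnorm H x)\<^sup>2 \<le> - Re (form H x x)"
proof -
  let ?a = "analysis x"
  have form_eq: "form H x x = ell2_inner I\<^sub>p ?a ?a - ell2_inner I\<^sub>n ?a ?a"
    using analysis_adjoint[OF analysis_in[OF x] x] id[OF x] by (simp add: ell2_form_eq)
  have le: "\<alpha> * (hnorm H x)\<^sup>2 \<le> (\<Sum>\<^sub>\<infinity>i\<in>I. (cmod (?a i))\<^sup>2)"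
    using lower[of "J x"] x by (simp add: analysis_sq(2) hnorm_J)
  have shrink: "Re (ell2_inner A ?a ?a) = (\<Sum>\<^sub>\<infinity>i\<in>I. (cmod (?a i))\<^sup>2)"
    if "?a \<in> ell2 A" "A \<subseteq> I" for A
  proof -
    have "(\<Sum>\<^sub>\<infinity>i\<in>A. (cmod (?a i))\<^sup>2) = (\<Sum>\<^sub>\<infinity>i\<in>I. (cmod (?a i))\<^sup>2)"
      using that ell2_outside[OF that(1)] by (intro infsum_cong_neutral) auto
    then show ?thesis using ell2_inner_self[OF that(1)] by simp
  qed
  show "\<alpha> * (hnorm H x)\<^sup>2 \<le> Re (form H x x)" if "?a \<in> ell2 I\<^sub>p"
    using form_eq le shrink[OF that idx_subset(1)] ell2_inner_outside(1)[OF idx_Int(2) that] by simp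
  show "\<alpha> * (hnorm H x)\<^sup>2 \<le> - Re (form H x x)" if "?a \<in> ell2 I\<^sub>n"
    using form_eq le shrink[OF that idx_subset(2)] ell2_inner_outside(1)[OF idx_Int(1) that] by simp
qed

text \<open>
  Everything takes place in \<open>H\<close>: the dilation \<open>K\<close> enters only through the numerical expansion of
  \<open>[x, z]\<close> and through the orthogonality of \<open>f i\<close> and \<open>f j\<close> for indices of opposite sign. In particular
  the norms of \<open>H\<close> and \<open>K\<close> are never compared.
\<close>

lemma dilation_imp_parseval:
  fixes K :: "'k::ab_group_add krein"
  assumes dil: "regular_dilation H I f K \<iota> b \<epsilon> E"
    and \<alpha>: "\<alpha> > 0" and lower: "\<And>x. x \<in> pts H \<Longrightarrow>
      \<alpha> * (hnorm H x)\<^sup>2 \<le> (\<Sum>\<^sub>\<infinity>i\<in>I. (cmod (hinner H x (f i)))\<^sup>2)"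
  shows "parseval_J_frame H I f"
proof -
  have krein_K: "krein_space K" and contains: "contains_via K H \<iota>"
    and onb: "orthonormal_basis K I b \<epsilon>"
    and pos: "\<iota> ` f ` I\<^sub>p \<subseteq> pos K" and neg: "\<iota> ` f ` I\<^sub>n \<subseteq> neg K"
    and proj: "selfadjoint_projection_onto K (\<iota> ` pts H) E"
    and Eb: "\<And>i. i \<in> I \<Longrightarrow> E (b i) = \<iota> (f i)"
    and sign: "\<And>i. i \<in> I \<Longrightarrow> f i \<noteq> 0 \<Longrightarrow> \<epsilon> i = (if i \<in> I\<^sub>p then 1 else - 1)"
    using dil by (auto simp: regular_dilation_def)
  interpret K: krein K by unfold_locales (rule krein_K)
  have \<iota>_in: "\<iota> x \<in> pts K" if "x \<in> pts H" for x
    using contains that by (auto simp: contains_via_def linear_between_def)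
  have \<iota>_form: "form K (\<iota> x) (\<iota> y) = form H x y" if "x \<in> pts H" "y \<in> pts H" for x y
    using contains that by (simp add: contains_via_def)
  have b_in: "b i \<in> pts K" if "i \<in> I" for i using onb that by (auto simp: orthonormal_basis_def)
  have E_\<iota>: "E (\<iota> x) = \<iota> x" if "x \<in> pts H" for x
  proof -
    have "\<iota> x \<in> E ` pts K" using proj that by (simp add: selfadjoint_projection_onto_def)
    then obtain y where "y \<in> pts K" "\<iota> x = E y" by blast
    then show ?thesis using proj by (simp add: selfadjoint_projection_onto_def)
  qed
  have E_adj: "form K (E x) y = form K x (E y)" if "x \<in> pts K" "y \<in> pts K" for x y
    using proj that by (simp add: selfadjoint_projection_onto_def krein_adjoint_def)
  \<comment> \<open>\<open>E\<close> fixes \<open>\<iota> x\<close>, and moving it to the second argument turns \<open>b i\<close> into \<open>\<iota> (f i)\<close>.\<close>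
  have coeff: "form K (\<iota> x) (b i) = form H x (f i)" if "x \<in> pts H" "i \<in> I" for x i
    using E_adj[OF \<iota>_in[OF that(1)] b_in[OF that(2)]] that by (simp add: E_\<iota> Eb \<iota>_form)
  have expansion: "((\<lambda>i. analysis x i * form H (f i) z) has_sum form H x z) I"
    if x: "x \<in> pts H" and z: "z \<in> pts H" for x z
  proof -
    have "has_usum K (\<lambda>i. scl K (\<epsilon> i * form K (\<iota> x) (b i)) (b i)) I (\<iota> x)"
      using onb \<iota>_in[OF x] by (simp add: orthonormal_basis_def)
    from K.has_usum_form[OF this _ \<iota>_in[OF z]]
    have "((\<lambda>i. form K (scl K (\<epsilon> i * form K (\<iota> x) (b i)) (b i)) (\<iota> z)) has_sum form H x z) I"
      using b_in x z by (simp add: \<iota>_form)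
    moreover have "form K (scl K (\<epsilon> i * form K (\<iota> x) (b i)) (b i)) (\<iota> z) =
        analysis x i * form H (f i) z" if i: "i \<in> I" for i
    proof -
      have "form K (b i) (\<iota> z) = form H (f i) z"
        using coeff[OF z i] K.form_commute[OF \<iota>_in[OF z] b_in[OF i]] form_commute[OF z f_in[OF i]]
        by simp
      then have "form K (scl K (\<epsilon> i * form K (\<iota> x) (b i)) (b i)) (\<iota> z) =
          \<epsilon> i * form H x (f i) * form H (f i) z"
        using K.form_scale_left[OF b_in[OF i] \<iota>_in[OF z]] coeff[OF x i] by simp
      \<comment> \<open>The sign of \<open>b i\<close> is prescribed only where \<open>f i \<noteq> 0\<close>, and elsewhere both sides vanish.\<close>
      moreover have "\<epsilon> i * form H x (f i) = analysis x i"
        using sign[OF i] i x idx_Un by (cases "f i = 0") (auto simp: analysis_def)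
      ultimately show ?thesis by simp
    qed
    ultimately show ?thesis by (rule_tac has_sum_cong[THEN iffD1]) auto
  qed
  have id: "T (analysis x) = x" if "x \<in> pts H" for x
    using that by (intro synthesis_eqI expansion) auto
  have orth: "form H (f i) (f j) = 0" if "i \<in> I\<^sub>p" "j \<in> I\<^sub>n" for i j
  proof -
    have "form K (\<iota> (f i)) (\<iota> (f j)) = 0"
      using that pos neg by (intro K.form_pos_neg) auto
    then show ?thesis using \<iota>_form[of "f i" "f j"] that idx_subset by auto
  qed
  have orth': "form H (f j) (f i) = 0" if "i \<in> I\<^sub>p" "j \<in> I\<^sub>n" for i j
    using orth[OF that] form_commute[of "f i" "f j"] that idx_subset by auto
  have supp_p: "analysis x \<in> ell2 I\<^sub>p" if x: "x \<in> T ` ell2 I\<^sub>p" for x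
  proof -
    obtain u where u: "u \<in> ell2 I\<^sub>p" "x = T u" using x by blast
    have "form H x (f j) = 0" if j: "j \<in> I\<^sub>n" for j
      using synthesis_orthogonal[OF idx_subset orth u(1) ell2_unit_in[OF j]] u(2)
        synthesis_unit[of j] j idx_subset by auto
    then have out: "analysis x i = 0" if "i \<notin> I\<^sub>p" for i using that by (simp add: analysis_def)
    have "ell2_restrict I\<^sub>p (analysis x) = analysis x"
      using out by (auto simp: ell2_restrict_def fun_eq_iff)
    then show ?thesis
      using ell2_restrict_in[OF analysis_in idx_subset(1), of x] u ell2_mono[OF u(1) idx_subset(1)]
      by simp
  qed
  have supp_n: "analysis x \<in> ell2 I\<^sub>n" if x: "x \<in> T ` ell2 I\<^sub>n" for x
  proof -
    obtain u where u: "u \<in> ell2 I\<^sub>n" "x = T u" using x by blast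
    have "form H x (f j) = 0" if j: "j \<in> I\<^sub>p" for j
      using synthesis_orthogonal[OF idx_subset(2,1) orth' u(1) ell2_unit_in[OF j]] u(2)
        synthesis_unit[of j] j idx_subset by auto
    then have out: "analysis x i = 0" if "i \<notin> I\<^sub>n" for i using that by (simp add: analysis_def)
    have "ell2_restrict I\<^sub>n (analysis x) = analysis x"
      using out by (auto simp: ell2_restrict_def fun_eq_iff)
    then show ?thesis
      using ell2_restrict_in[OF analysis_in idx_subset(2), of x] u ell2_mono[OF u(1) idx_subset(2)]
      by simp
  qed
  note sub = subspace_of_range_synthesis[OF idx_subset(1)] subspace_of_range_synthesis[OF idx_subset(2)]
  have "unif_pos H (T ` ell2 I\<^sub>p)"
    unfolding unif_pos_def
  proof (intro conjI exI[of _ \<alpha>] ballI sub \<alpha>)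
    fix x assume x: "x \<in> T ` ell2 I\<^sub>p"
    then have "x \<in> pts H" using sub by (auto simp: subspace_of_def)
    then show "\<alpha> * (hnorm H x)\<^sup>2 \<le> Re (form H x x)"
      using uniform_bounds(1)[OF lower id] supp_p[OF x] by blast
  qed
  moreover have "unif_neg H (T ` ell2 I\<^sub>n)"
    unfolding unif_neg_def
  proof (intro conjI exI[of _ \<alpha>] ballI sub \<alpha>)
    fix x assume x: "x \<in> T ` ell2 I\<^sub>n"
    then have "x \<in> pts H" using sub by (auto simp: subspace_of_def)
    then show "\<alpha> * (hnorm H x)\<^sup>2 \<le> - Re (form H x x)"
      using uniform_bounds(2)[OF lower id] supp_n[OF x] by blast
  qed
  moreover have "\<exists>s\<in>T ` ell2 I\<^sub>p. \<exists>r\<in>T ` ell2 I\<^sub>n. x = s + r" if x: "x \<in> pts H" for x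
    using synthesis_split[OF analysis_in[OF x]] id[OF x]
      ell2_restrict_in[OF analysis_in[OF x] idx_subset(1)]
      ell2_restrict_in[OF analysis_in[OF x] idx_subset(2)] by (metis imageI)
  ultimately have "J_frame H I f"
    unfolding J_frame_iff using maximal_unif_decomposition by blast
  then show ?thesis using id by (simp add: parseval_J_frame_iff)
qed

end

section \<open>The equivalence\<close>

theorem theorem5p9:
  fixes H :: "'a::ab_group_add krein" and I :: "'i set" and f :: "'i \<Rightarrow> 'a"
  assumes "krein_space H"
    and "frame H I f"
  shows "(parseval_J_frame H I f \<longleftrightarrow>
            (\<exists>(K :: ('i \<Rightarrow> complex) krein) \<iota> b \<epsilon> E. regular_dilation H I f K \<iota> b \<epsilon> E)) \<and>
         ((\<exists>(K :: ('k::ab_group_add) krein) \<iota> b \<epsilon> E. regular_dilation H I f K \<iota> b \<epsilon> E) \<longrightarrow>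
            parseval_J_frame H I f)"
proof -
  obtain \<alpha> \<beta> where "0 < \<alpha>" "\<alpha> \<le> \<beta>" and frame: "f ` I \<subseteq> pts H" "\<And>x. x \<in> pts H \<Longrightarrow>
        (\<lambda>i. (cmod (hinner H x (f i)))\<^sup>2) summable_on I \<and>
        \<alpha> * (hnorm H x)\<^sup>2 \<le> (\<Sum>\<^sub>\<infinity>i\<in>I. (cmod (hinner H x (f i)))\<^sup>2) \<and>
        (\<Sum>\<^sub>\<infinity>i\<in>I. (cmod (hinner H x (f i)))\<^sup>2) \<le> \<beta> * (hnorm H x)\<^sup>2"
    using assms(2) unfolding frame_def by metis
  interpret bessel H I f \<beta>
    using assms(1) frame \<open>0 < \<alpha>\<close> \<open>\<alpha> \<le> \<beta>\<close> by unfold_locales auto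
  have lower: "\<alpha> * (hnorm H x)\<^sup>2 \<le> (\<Sum>\<^sub>\<infinity>i\<in>I. (cmod (hinner H x (f i)))\<^sup>2)" if "x \<in> pts H" for x
    using frame(2)[OF that] by blast
  show ?thesis
  proof (intro conjI iffI impI)
    assume "parseval_J_frame H I f"
    then show "\<exists>(K :: ('i \<Rightarrow> complex) krein) \<iota> b \<epsilon> E. regular_dilation H I f K \<iota> b \<epsilon> E"
      using parseval_imp_dilation by blast
  next
    assume "\<exists>(K :: ('i \<Rightarrow> complex) krein) \<iota> b \<epsilon> E. regular_dilation H I f K \<iota> b \<epsilon> E"
    then show "parseval_J_frame H I f"
      using dilation_imp_parseval \<open>0 < \<alpha>\<close> lower by metis
  next
    assume "\<exists>(K :: 'k krein) \<iota> b \<epsilon> E. regular_dilation H I f K \<iota> b \<epsilon> E"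
    then show "parseval_J_frame H I f"
      using dilation_imp_parseval \<open>0 < \<alpha>\<close> lower by metis
  qed
qed
end
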